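(* Let $F(z)=\sum_{s=1}^{\mu}\frac{v_s}{z-z_s}+u(z)$ be a vector-valued rational function, where $u$ is a polynomial with values in $\mathbb{C}^N$, $z_1,\dots,z_\mu$ are distinct complex numbers, and $v_1,\dots,v_\mu\in\mathbb{C}^N$ are nonzero. Assume that $F$ is analytic in $E$ (so that $z_1,\dots,z_\mu\in K$), with poles ordered so that $\Phi(z_1)\le\Phi(z_2)\le\cdots\le\Phi(z_\mu)$. Let $1\le k<\mu$ be fixed and assume $$\Phi(z_k)<\Phi(z_{k+1})=\cdots=\Phi(z_{k+r})<\Phi(z_{k+r+1}),$$ where $\Phi(z_{k+r+1})$ is defined to be $\infty$ in case $k+r=\mu$. Assume also that $\prod_{i=1}^k(q,v_i)\neq0$. Let $z_m^{(p)}$, $m=1,\dots,k$, be the zeros of $V_{p,k}(z)$, labelled so that $\lim_{p\to\infty}z_m^{(p)}=z_m$. Then, for $m=1,\dots,k$, $$z_m^{(p)}-z_m=O\Big(\frac{\Psi_p(z_m)}{\widetilde\Psi_{p,k}}\Big)\quad\text{as }p\to\infty,\qquad |\widetilde\Psi_{p,k}|=\min_{1\le j\le r}|\Psi_p(z_{k+j})|,$$ and consequently $$\limsup_{p\to\infty}|z_m^{(p)}-z_m|^{1/p}\le\frac{\Phi(z_m)}{\Phi(z_{k+1})},\quad m=1,\dots,k.$$ In case $r=1$, that is, $\Phi(z_k)<\Phi(z_{k+1})<\Phi(z_{k+2})$, and assuming that $T_{1,\dots,m-1,m+1,\dots,k+1}\ne0$, one has the more refined result $$z_m^{(p)}-z_m\sim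 C_m\frac{\Psi_p(z_m)}{\Psi_p(z_{k+1})}\quad\text{as }p\to\infty,$$ $$C_m=(-1)^{k-m}\,\frac{T_{1,\dots,m-1,m+1,\dots,k+1}}{T_{1,\dots,k}}\,(z_{k+1}-z_m)\prod_{\substack{i=1\\ i\ne m}}^k\frac{z_{k+1}-z_i}{z_m-z_i}.$$
   Context: Sets and interpolation points. $E$ is a closed and bounded set in the complex plane whose complement $K$ (which includes the point at infinity) has a classical Green's function $g(z)$ with pole at infinity, continuous on $\partial E$ and zero on $\partial E$. Put $\Phi(z)=\exp[g(z)]$ and $\kappa=\mathrm{cap}(E)$, the logarithmic capacity of $E$. For each $p\in\{1,2,\dots\}$ there is given a set of interpolation points $\xi^{(p)}_1,\dots,\xi^{(p)}_{p+k}$, not necessarily distinct (equal points being listed consecutively), such that the $\xi_i^{(p)}$ have no limit points in $K$ and $$\lim_{p\to\infty}\Big|\prod_{i=1}^{p+k}(z-\xi_i^{(p)})\Big|^{1/p}=\kappa\,\Phi(z)$$ uniformly in $z$ on every compact subset of $K$. For fixed $p$ write $\xi_i=\xi_i^{(p)}$. The ITEA construction. $(\cdot,\cdot)$ is an inner product on $\mathbb{C}^N$ (linear in its second argument) and $q\in\mathbb{C}^N$ is a fixed nonzero vector. Put $\psi_{m,n}(z)=\prod_{r=m}^n(z-\xi_r)$ for $n\ge m\ge1$, $\psi_{m,m-1}(z)=1$, and $\Psi_p(z)=\psi_{1,p+k}(z)$. Let $D_{m,n}=F[\xi_m,\dots,\xi_n]$ be the divided difference of $F$ over $\{\xi_m,\dots,\xi_n\}$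 (in the generalized Hermite sense if points coincide), and put $u_{i,j}=(q,D_{j+1,p+i})$. The denominator polynomial is $V_{p,k}(z)=\sum_{j=0}^kc_j\psi_{1,j}(z)$, where $c_k=1$ and $c_0,\dots,c_{k-1}$ solve $\sum_{j=0}^{k-1}u_{i,j}c_j=-u_{i,k}$, $i=1,\dots,k$ (uniquely solvable when $\det(u_{i,j})_{1\le i\le k,\,0\le j\le k-1}\ne0$). Under the hypotheses of the claim, $V_{p,k}$ converges to $\prod_{i=1}^k(z-z_i)$ as $p\to\infty$, so its $k$ zeros can be labelled as in the claim for all large $p$. Determinants. $T_{s_1,\dots,s_k}=\det(\alpha_{i,s_j})_{1\le i,j\le k}$, where $\alpha_{i,s}=(q,v_s)\,\psi_{p+i+1,p+k}(z_s)$; this determinant does not depend on $p$, and $T_{1,\dots,k}\ne0$ under the hypotheses of the claim. *)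

theory Defs
  imports
    "Jordan_Normal_Form.Determinant"
    "HOL-Probability.Probability"
    "HOL-Complex_Analysis.Complex_Analysis"
    "HOL-Library.Landau_Symbols"
begin

definition inner_product_on_Cn :: "(complex ^ 'n \<Rightarrow> complex ^ 'n \<Rightarrow> complex) \<Rightarrow> bool" where
  "inner_product_on_Cn ip \<longleftrightarrow>
     (\<forall>x y. ip y x = cnj (ip x y)) \<and>
     (\<forall>x y z. ip x (y + z) = ip x y + ip x z) \<and>
     (\<forall>c x y. ip x (c *s y) = c * ip x y) \<and>
     (\<forall>x. x \<noteq> 0 \<longrightarrow> Re (ip x x) > 0)"

definition has_directional_deriv_on ::
    "(complex \<Rightarrow> real) \<Rightarrow> (complex \<Rightarrow> real) \<Rightarrow> complex \<Rightarrow> complex set \<Rightarrow> bool" where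
  "has_directional_deriv_on f f' w S \<longleftrightarrow>
     (\<forall>z\<in>S. ((\<lambda>t::real. f (z + of_real t * w)) has_real_derivative f' z) (at 0))"

text \<open>Twice continuously differentiable solutions of the Laplace equation; meant for open sets
  (the partial derivatives are two-sided and are taken in the directions \<open>1\<close> and \<open>\<i>\<close>).\<close>

definition harmonic_on :: "(complex \<Rightarrow> real) \<Rightarrow> complex set \<Rightarrow> bool" where
  "harmonic_on g S \<longleftrightarrow>
     (\<exists>gx gy gxx gxy gyx gyy.
        has_directional_deriv_on g gx 1 S \<and> has_directional_deriv_on g gy \<i> S \<and>
        has_directional_deriv_on gx gxx 1 S \<and> has_directional_deriv_on gx gxy \<i> S \<and>
        has_directional_deriv_on gy gyx 1 S \<and> has_directional_deriv_on gy gyy \<i> S \<and>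
        continuous_on S g \<and> continuous_on S gx \<and> continuous_on S gy \<and>
        continuous_on S gxx \<and> continuous_on S gxy \<and> continuous_on S gyx \<and> continuous_on S gyy \<and>
        (\<forall>z\<in>S. gxx z + gyy z = 0))"

text \<open>Classical Green's function with pole at infinity of the complement of a compact set \<open>E\<close> in
  the Riemann sphere. Only the values of \<open>g\<close> on the closure of \<open>- E\<close> matter. Connectedness of the
  complement is not demanded; on bounded components of \<open>- E\<close> these conditions force \<open>g = 0\<close>.\<close>

definition classical_green_function :: "complex set \<Rightarrow> (complex \<Rightarrow> real) \<Rightarrow> bool" where
  "classical_green_function E g \<longleftrightarrow>
     harmonic_on g (- E) \<and>
     (\<exists>\<gamma>. ((\<lambda>z. g z - ln (cmod z)) \<longlongrightarrow> \<gamma>) at_infinity) \<and>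
     continuous_on (closure (- E)) g \<and>
     (\<forall>z\<in>frontier E. g z = 0)"

text \<open>Logarithmic capacity of a compact set, \<open>sup exp (I M)\<close> with
  \<open>I M = \<integral>\<integral> log |z - w| dM dM\<close>, the supremum being over the Borel probability measures \<open>M\<close>
  carried by \<open>E\<close>. Measures with \<open>I M = -\<infinity>\<close> contribute the value \<open>0\<close>. As \<open>ln 0 = 0\<close> here, the
  requirement that the diagonal be null is what excludes measures with atoms.\<close>

definition logarithmic_capacity :: "complex set \<Rightarrow> real" where
  "logarithmic_capacity E =
     Sup (insert 0 {exp (\<integral>zw. ln (cmod (fst zw - snd zw)) \<partial>(M \<Otimes>\<^sub>M M)) | M :: complex measure.
       prob_space M \<and> sets M = sets borel \<and> (AE z in M. z \<in> E) \<and>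
       (AE zw in M \<Otimes>\<^sub>M M. fst zw \<noteq> snd zw) \<and>
       integrable (M \<Otimes>\<^sub>M M) (\<lambda>zw. ln (cmod (fst zw - snd zw)))})"

text \<open>\<open>divided_difference f x m d\<close> is \<open>f[x\<^sub>m, \<dots>, x\<^sub>m\<^sub>+\<^sub>d]\<close> in the Hermite sense. Equal points among
  \<open>x\<^sub>m, \<dots>, x\<^sub>m\<^sub>+\<^sub>d\<close> have to be listed consecutively: then equality of the two end points means that all
  the points coincide.\<close>

fun divided_difference :: "(complex \<Rightarrow> complex) \<Rightarrow> (nat \<Rightarrow> complex) \<Rightarrow> nat \<Rightarrow> nat \<Rightarrow> complex" where
  "divided_difference f x m 0 = f (x m)"
| "divided_difference f x m (Suc d) =
     (if x (m + Suc d) = x m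
      then (deriv ^^ Suc d) f (x m) / fact (Suc d)
      else (divided_difference f x (Suc m) d - divided_difference f x m d) / (x (m + Suc d) - x m))"

text \<open>\<open>D\<^sub>m\<^sub>,\<^sub>n = F[x\<^sub>m, \<dots>, x\<^sub>n]\<close>, meaningful for \<open>m \<le> n\<close>.\<close>

definition vector_divided_difference ::
    "(complex \<Rightarrow> complex ^ 'n) \<Rightarrow> (nat \<Rightarrow> complex) \<Rightarrow> nat \<Rightarrow> nat \<Rightarrow> complex ^ 'n" where
  "vector_divided_difference F x m n =
     vec_lambda (\<lambda>i. divided_difference (\<lambda>z. vec_nth (F z) i) x m (n - m))"

definition node_poly :: "(nat \<Rightarrow> complex) \<Rightarrow> nat \<Rightarrow> nat \<Rightarrow> complex \<Rightarrow> complex" where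
  "node_poly x m n z = (\<Prod>r=m..n. z - x r)"

text \<open>In the next four definitions \<open>x\<close> is the list \<open>\<xi>\<^sup>(\<^sup>p\<^sup>)\<close> of interpolation points belonging to \<open>p\<close>.
  The entries \<open>u\<^sub>i\<^sub>,\<^sub>j\<close> with \<open>1 \<le> i \<le> k\<close>, \<open>j \<le> k\<close> are meaningful as soon as \<open>p \<ge> k\<close>.\<close>

definition itea_u ::
    "(complex ^ 'n \<Rightarrow> complex ^ 'n \<Rightarrow> complex) \<Rightarrow> complex ^ 'n \<Rightarrow> (complex \<Rightarrow> complex ^ 'n) \<Rightarrow>
     (nat \<Rightarrow> complex) \<Rightarrow> nat \<Rightarrow> nat \<Rightarrow> nat \<Rightarrow> complex" where
  "itea_u ip q F x p i j = ip q (vector_divided_difference F x (j + 1) (p + i))"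

text \<open>Matrices in \<^theory>\<open>Jordan_Normal_Form.Matrix\<close> are indexed from \<open>0\<close>; the rows here are
  \<open>i = 1, \<dots>, k\<close>, the columns \<open>j = 0, \<dots>, k - 1\<close>.\<close>

definition itea_det ::
    "(complex ^ 'n \<Rightarrow> complex ^ 'n \<Rightarrow> complex) \<Rightarrow> complex ^ 'n \<Rightarrow> (complex \<Rightarrow> complex ^ 'n) \<Rightarrow>
     (nat \<Rightarrow> complex) \<Rightarrow> nat \<Rightarrow> nat \<Rightarrow> complex" where
  "itea_det ip q F x p k =
     Determinant.det (Matrix.mat k k (\<lambda>(i, j). itea_u ip q F x p (i + 1) j))"

text \<open>The solution \<open>c\<^sub>0, \<dots>, c\<^sub>k\<close> (continued by \<open>0\<close>); it is unique whenever \<^const>\<open>itea_det\<close> does not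
  vanish, and only then is the description below meaningful.\<close>

definition itea_coeffs ::
    "(complex ^ 'n \<Rightarrow> complex ^ 'n \<Rightarrow> complex) \<Rightarrow> complex ^ 'n \<Rightarrow> (complex \<Rightarrow> complex ^ 'n) \<Rightarrow>
     (nat \<Rightarrow> complex) \<Rightarrow> nat \<Rightarrow> nat \<Rightarrow> nat \<Rightarrow> complex" where
  "itea_coeffs ip q F x p k =
     (THE c. (\<forall>j>k. c j = 0) \<and> c k = 1 \<and>
        (\<forall>i\<in>{1..k}. (\<Sum>j<k. itea_u ip q F x p i j * c j) = - itea_u ip q F x p i k))"

definition itea_denominator ::
    "(complex ^ 'n \<Rightarrow> complex ^ 'n \<Rightarrow> complex) \<Rightarrow> complex ^ 'n \<Rightarrow> (complex \<Rightarrow> complex ^ 'n) \<Rightarrow>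
     (nat \<Rightarrow> complex) \<Rightarrow> nat \<Rightarrow> nat \<Rightarrow> complex \<Rightarrow> complex" where
  "itea_denominator ip q F x p k z =
     (\<Sum>j=0..k. itea_coeffs ip q F x p k j * node_poly x 1 j z)"

text \<open>The determinant \<open>T\<close> for the list \<open>ss = [s\<^sub>1, \<dots>, s\<^sub>k]\<close> of column indices, with entries
  \<open>\<alpha>\<^sub>i\<^sub>,\<^sub>s = (q, v\<^sub>s) \<psi>\<^sub>p\<^sub>+\<^sub>i\<^sub>+\<^sub>1\<^sub>,\<^sub>p\<^sub>+\<^sub>k(z\<^sub>s)\<close>. Its value does not depend on \<open>x\<close> and \<open>p\<close>.\<close>

definition itea_alpha ::
    "(complex ^ 'n \<Rightarrow> complex ^ 'n \<Rightarrow> complex) \<Rightarrow> complex ^ 'n \<Rightarrow> (nat \<Rightarrow> complex ^ 'n) \<Rightarrow>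
     (nat \<Rightarrow> complex) \<Rightarrow> (nat \<Rightarrow> complex) \<Rightarrow> nat \<Rightarrow> nat \<Rightarrow> nat \<Rightarrow> nat \<Rightarrow> complex" where
  "itea_alpha ip q v \<zeta> x p k i s = ip q (v s) * node_poly x (p + i + 1) (p + k) (\<zeta> s)"

definition itea_T ::
    "(complex ^ 'n \<Rightarrow> complex ^ 'n \<Rightarrow> complex) \<Rightarrow> complex ^ 'n \<Rightarrow> (nat \<Rightarrow> complex ^ 'n) \<Rightarrow>
     (nat \<Rightarrow> complex) \<Rightarrow> (nat \<Rightarrow> complex) \<Rightarrow> nat \<Rightarrow> nat \<Rightarrow> nat list \<Rightarrow> complex" where
  "itea_T ip q v \<zeta> x p k ss =
     Determinant.det (Matrix.mat k k (\<lambda>(i, j). itea_alpha ip q v \<zeta> x p k (i + 1) (ss ! j)))"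

definition itea_C ::
    "(complex ^ 'n \<Rightarrow> complex ^ 'n \<Rightarrow> complex) \<Rightarrow> complex ^ 'n \<Rightarrow> (nat \<Rightarrow> complex ^ 'n) \<Rightarrow>
     (nat \<Rightarrow> complex) \<Rightarrow> (nat \<Rightarrow> complex) \<Rightarrow> nat \<Rightarrow> nat \<Rightarrow> nat \<Rightarrow> complex" where
  "itea_C ip q v \<zeta> x p k m =
     (-1) ^ (k - m)
     * (itea_T ip q v \<zeta> x p k ([1..<m] @ [m + 1..<k + 2]) / itea_T ip q v \<zeta> x p k [1..<k + 1])
     * (\<zeta> (k + 1) - \<zeta> m) * (\<Prod>i\<in>{1..k} - {m}. (\<zeta> (k + 1) - \<zeta> i) / (\<zeta> m - \<zeta> i))"

text \<open>\<open>zp p 1, \<dots>, zp p k\<close> are, for all large \<open>p\<close>, the zeros of the monic polynomial function \<open>V p\<close>,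
  counted with multiplicity, labelled so that \<open>zp p m \<longlonglongrightarrow> \<zeta> m\<close>.\<close>

definition labelled_zeros ::
    "(nat \<Rightarrow> complex \<Rightarrow> complex) \<Rightarrow> nat \<Rightarrow> (nat \<Rightarrow> complex) \<Rightarrow> (nat \<Rightarrow> nat \<Rightarrow> complex) \<Rightarrow> bool" where
  "labelled_zeros V k \<zeta> zp \<longleftrightarrow>
     (\<forall>\<^sub>F p in sequentially. \<forall>z. V p z = (\<Prod>m=1..k. z - zp p m)) \<and>
     (\<forall>m\<in>{1..k}. (\<lambda>p. zp p m) \<longlonglongrightarrow> \<zeta> m)"

end

theory Submission
  imports Defs "HOL-Computational_Algebra.Fundamental_Theorem_Algebra"
begin

text \<open>Write \<open>w\<^sub>s = (q, v\<^sub>s)\<close>. Divided differences of high order kill \<open>u\<close> and send \<open>1 / (z - z\<^sub>s)\<close> to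
  \<open>- 1 / \<psi>(z\<^sub>s)\<close>, so the linear system for the denominator \<open>V\<close> says that
  \<open>\<Sum>\<^sub>s w\<^sub>s V(z\<^sub>s) h(z\<^sub>s) / \<Psi>\<^sub>p(z\<^sub>s) = 0\<close> for all polynomials \<open>h\<close> of degree below \<open>k\<close>. Taking for \<open>h\<close>
  the Lagrange basis polynomial \<open>l\<^sub>m\<close> of the nodes \<open>z\<^sub>1, \<dots>, z\<^sub>k\<close> gives
  \<open>V(z\<^sub>m) = - \<Sum>\<^sub>s\<^sub>>\<^sub>k (w\<^sub>s / w\<^sub>m) l\<^sub>m(z\<^sub>s) (\<Psi>\<^sub>p(z\<^sub>m) / \<Psi>\<^sub>p(z\<^sub>s)) V(z\<^sub>s)\<close>.
  The quotients of the \<open>\<Psi>\<^sub>p\<close> decay geometrically, and \<open>V(z\<^sub>s)\<close> is controlled by the leading coefficient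
  and the values at \<open>z\<^sub>1, \<dots>, z\<^sub>k\<close> through interpolation. Hence the homogeneous system has only the
  trivial solution, the values \<open>V(z\<^sub>m)\<close> tend to \<open>0\<close>, and each \<open>z\<^sub>m\<close> attracts exactly one zero of \<open>V\<close>.
  Dividing \<open>V(z\<^sub>m) = \<Prod>\<^sub>i (z\<^sub>m - z\<^sub>i\<^sup>(\<^sup>p\<^sup>))\<close> by the factors with \<open>i \<noteq> m\<close> turns the displayed identity into
  an exact formula for \<open>z\<^sub>m\<^sup>(\<^sup>p\<^sup>) - z\<^sub>m\<close>, from which all the asymptotic claims are read off.\<close>

section \<open>Divided differences of rational functions\<close>

text \<open>The recursion of \<open>divided_difference\<close> compares only the two end points.
  This condition turns equality of the end points into coincidence of all points between them, and
  it passes to subintervals, as inductions on the order require.\<close>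

definition equal_points_adjacent :: "(nat \<Rightarrow> complex) \<Rightarrow> nat \<Rightarrow> nat \<Rightarrow> bool" where
  "equal_points_adjacent x a b \<longleftrightarrow>
     (\<forall>i j l. a \<le> i \<longrightarrow> i \<le> j \<longrightarrow> j \<le> l \<longrightarrow> l \<le> b \<longrightarrow> x i = x l \<longrightarrow> x j = x i)"

lemma equal_points_adjacent_subinterval:
  "equal_points_adjacent x a b \<Longrightarrow> a \<le> a' \<Longrightarrow> b' \<le> b \<Longrightarrow> equal_points_adjacent x a' b'"
  unfolding equal_points_adjacent_def by (meson order_trans)

lemma equal_points_adjacentD:
  "equal_points_adjacent x a b \<Longrightarrow> x a = x b \<Longrightarrow> a \<le> j \<Longrightarrow> j \<le> b \<Longrightarrow> x j = x a"
  unfolding equal_points_adjacent_def by blast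

section \<open>Divided differences of polynomials\<close>

lemma higher_deriv_poly: "(deriv ^^ n) (poly P) = poly ((pderiv ^^ n) P)" for P :: "complex poly"
proof (induction n)
  case (Suc n)
  have "deriv (poly Q) = poly (pderiv Q)" for Q :: "complex poly"
    by (rule ext, rule DERIV_imp_deriv, rule poly_DERIV)
  then show ?case using Suc by simp
qed simp

text \<open>\<open>pCons a P\<close> is a + X P. In the Leibniz rule for X P only two terms survive,
  since X has no derivatives beyond the first; the constant a is already gone at order one.\<close>

lemma higher_pderiv_pCons:
  "(pderiv ^^ Suc n) (pCons a P) = pCons 0 ((pderiv ^^ Suc n) P) + of_nat (Suc n) * (pderiv ^^ n) P"
  for P :: "complex poly"
proof (induction n)
  case 0
  then show ?case by (simp add: pderiv_pCons)
next
  case (Suc n)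
  have "(pderiv ^^ Suc (Suc n)) (pCons a P) =
      pderiv (pCons 0 ((pderiv ^^ Suc n) P) + of_nat (Suc n) * (pderiv ^^ n) P)"
    using Suc by simp
  also have "\<dots> = pCons 0 ((pderiv ^^ Suc (Suc n)) P) + of_nat (Suc (Suc n)) * (pderiv ^^ Suc n) P"
    by (simp add: pderiv_add pderiv_pCons pderiv_mult pderiv_of_nat algebra_simps)
  finally show ?case .
qed

lemma divided_difference_coincident:
  assumes "\<And>j. m \<le> j \<Longrightarrow> j \<le> m + d \<Longrightarrow> x j = x m"
  shows "divided_difference f x m d = (deriv ^^ d) f (x m) / fact d"
proof (cases d)
  case (Suc e)
  then have "x (m + Suc e) = x m" by (intro assms) auto
  then show ?thesis using Suc by simp
qed simp

lemma divided_difference_poly_pCons_coincident: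
  assumes "\<And>j. m \<le> j \<Longrightarrow> j \<le> m + Suc d \<Longrightarrow> x j = x m"
  shows "divided_difference (poly (pCons a P)) x m (Suc d) =
     x m * divided_difference (poly P) x m (Suc d) + divided_difference (poly P) x (Suc m) d"
proof -
  have eq: "x (Suc m) = x m" by (rule assms) auto
  have "divided_difference (poly P) x (Suc m) d = (deriv ^^ d) (poly P) (x (Suc m)) / fact d"
    by (rule divided_difference_coincident) (metis assms eq Suc_leD add_Suc_shift)
  then have 1: "divided_difference (poly P) x (Suc m) d = (deriv ^^ d) (poly P) (x m) / fact d"
    unfolding eq .
  have 2: "divided_difference f x m (Suc d) = (deriv ^^ Suc d) f (x m) / fact (Suc d)" for f
    by (rule divided_difference_coincident, rule assms)
  have "(1 + of_nat d :: complex) \<noteq> 0" by (metis of_nat_Suc of_nat_eq_0_iff nat.distinct(1))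
  then show ?thesis
    unfolding 1 2 higher_deriv_poly higher_pderiv_pCons fact_Suc
    by (simp add: divide_simps del: funpow.simps)
qed

text \<open>The Leibniz rule for divided differences with factor z, whose own differences are x_m,
  1, 0, 0, and so on. Both differences on the right belong to the shorter coefficient list
  \<open>P\<close>, which permits induction over coefficients.\<close>

lemma divided_difference_poly_pCons:
  assumes "equal_points_adjacent x m (m + Suc d)"
  shows "divided_difference (poly (pCons a P)) x m (Suc d) =
     x m * divided_difference (poly P) x m (Suc d) + divided_difference (poly P) x (Suc m) d"
  using assms
proof (induction d arbitrary: m)
  case 0
  show ?case
  proof (cases "x (Suc m) = x m")
    case True
    then show ?thesis
      by (intro divided_difference_poly_pCons_coincident) (auto simp: le_Suc_eq)
  next
    case False
    then show ?thesis by (simp add: field_simps)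
  qed
next
  case (Suc d)
  let ?n = "Suc (Suc d)" and ?D = "divided_difference (poly P) x"
  show ?case
  proof (cases "x (m + ?n) = x m")
    case True
    have "x j = x m" if "m \<le> j" "j \<le> m + ?n" for j
      using equal_points_adjacentD[OF Suc.prems _ that] True by simp
    then show ?thesis by (rule divided_difference_poly_pCons_coincident)
  next
    case False
    have adj: "equal_points_adjacent x m (m + Suc d)" "equal_points_adjacent x (Suc m) (Suc m + Suc d)"
      using Suc.prems by (auto intro: equal_points_adjacent_subinterval)
    \<comment> \<open>This is the recursion on the interval from \<open>Suc m\<close> cleared of its
      denominator. In this form it includes coincident end points, where both sides are 0; inserted
      below, it eliminates the node \<open>x (Suc m)\<close>.\<close>
    have step: "?D (Suc (Suc m)) d - ?D (Suc m) d = (x (m + ?n) - x (Suc m)) * ?D (Suc m) (Suc d)"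
    proof (cases "x (m + ?n) = x (Suc m)")
      case True
      have eq: "x j = x (Suc m)" if "Suc m \<le> j" "j \<le> m + ?n" for j
        using equal_points_adjacentD[OF adj(2) _ that(1)] True that by simp
      have eq': "x j = x (Suc (Suc m))" if "Suc (Suc m) \<le> j" "j \<le> m + ?n" for j
        using eq[of j] eq[of "Suc (Suc m)"] that by simp
      have "?D (Suc m) d = (deriv ^^ d) (poly P) (x (Suc m)) / fact d"
        by (rule divided_difference_coincident, rule eq) auto
      moreover have "?D (Suc (Suc m)) d = (deriv ^^ d) (poly P) (x (Suc (Suc m))) / fact d"
        by (rule divided_difference_coincident, rule eq') auto
      moreover have "x (Suc (Suc m)) = x (Suc m)" by (rule eq) auto
      ultimately show ?thesis using True by simp
    qed simp
    let ?b = "x (m + ?n)" and ?e = "?D (Suc m) (Suc d)"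
    have "divided_difference (poly (pCons a P)) x m ?n =
       (divided_difference (poly (pCons a P)) x (Suc m) (Suc d) -
        divided_difference (poly (pCons a P)) x m (Suc d)) / (?b - x m)"
      using False by simp
    also have "\<dots> = (x (Suc m) * ?e + ?D (Suc (Suc m)) d - (x m * ?D m (Suc d) + ?D (Suc m) d)) / (?b - x m)"
      unfolding Suc.IH[OF adj(1)] Suc.IH[OF adj(2)] ..
    also have "x (Suc m) * ?e + ?D (Suc (Suc m)) d - (x m * ?D m (Suc d) + ?D (Suc m) d) =
        x m * (?e - ?D m (Suc d)) + (?b - x m) * ?e"
      using step by (simp only: algebra_simps)
    also have "\<dots> / (?b - x m) = x m * ((?e - ?D m (Suc d)) / (?b - x m)) + ?e"
      using False by (simp only: add_divide_distrib) simp
    also have "(?e - ?D m (Suc d)) / (?b - x m) = ?D m ?n"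
      using False by simp
    finally show ?thesis .
  qed
qed

lemma divided_difference_poly_0: "divided_difference (poly 0) x m d = 0"
proof -
  have "divided_difference (\<lambda>_. 0) x m d = 0"
    by (induction d arbitrary: m) (simp_all add: higher_deriv_poly[of _ 0, simplified])
  moreover have "poly 0 = (\<lambda>_. 0::complex)" by auto
  ultimately show ?thesis by simp
qed

lemma divided_difference_poly_eq_0:
  assumes "equal_points_adjacent x m (m + d)" "degree P < d"
  shows "divided_difference (poly P) x m d = 0"
  using assms
proof (induction P arbitrary: m d)
  case 0
  show ?case by (rule divided_difference_poly_0)
next
  case (pCons a P)
  obtain e where d: "d = Suc e" using pCons.prems(2) by (cases d) auto
  have adj: "equal_points_adjacent x (Suc m) (Suc m + e)"
    using pCons.prems(1) d by (auto intro: equal_points_adjacent_subinterval)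
  have "divided_difference (poly P) x m (Suc e) = 0 \<and> divided_difference (poly P) x (Suc m) e = 0"
  \<comment> \<open>The zero polynomial has degree 0, so for \<open>e = 0\<close> the induction
    hypothesis would not apply to it.\<close>
  proof (cases "P = 0")
    case True
    then show ?thesis by (simp only: divided_difference_poly_0 simp_thms)
  next
    case False
    then have "degree P < d" "degree P < e" using pCons.prems(2) d by auto
    then show ?thesis
      using pCons.IH[of m d] pCons.IH[of "Suc m" e] pCons.prems(1) adj d by blast
  qed
  then show ?case
    unfolding d divided_difference_poly_pCons[OF pCons.prems(1)[unfolded d], of a P] by simp
qed

section \<open>Divided differences of functions with simple poles\<close>

lemma higher_deriv_rational:
  fixes f :: "complex \<Rightarrow> complex"
  assumes f: "\<And>z. z \<notin> \<zeta> ` S \<Longrightarrow> f z = (\<Sum>s\<in>S. a s / (z - \<zeta> s)) + poly P z"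
    and S: "finite S" and z: "z \<notin> \<zeta> ` S"
  shows "(deriv ^^ n) f z = (\<Sum>s\<in>S. a s * (- 1) ^ n * fact n / (z - \<zeta> s) ^ Suc n) + poly ((pderiv ^^ n) P) z"
  using z
proof (induction n arbitrary: z)
  case 0
  then show ?case by (simp add: f)
next
  case (Suc n)
  let ?h = "\<lambda>z. (\<Sum>s\<in>S. a s * (- 1) ^ n * fact n / (z - \<zeta> s) ^ Suc n) + poly ((pderiv ^^ n) P) z"
  \<comment> \<open>The value of \<open>f\<close> is known only off the poles. These are finitely
    many, so the formula holds on a neighbourhood of \<open>z\<close> and may be
    differentiated.\<close>
  have "open (- (\<zeta> ` S))" using S by (intro open_Compl finite_imp_closed) auto
  then have "\<forall>\<^sub>F w in nhds z. (deriv ^^ n) f w = ?h w"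
    using Suc by (auto simp: eventually_nhds)
  then have "deriv ((deriv ^^ n) f) z = deriv ?h z" by (rule deriv_cong_ev) simp
  also have "\<dots> = (\<Sum>s\<in>S. a s * (- 1) ^ Suc n * fact (Suc n) / (z - \<zeta> s) ^ Suc (Suc n)) + poly ((pderiv ^^ Suc n) P) z"
  proof (rule DERIV_imp_deriv)
    have "((\<lambda>z. c / (z - \<zeta> s) ^ Suc n) has_field_derivative (- of_nat (Suc n) * c / (z - \<zeta> s) ^ Suc (Suc n))) (at z)"
      if "s \<in> S" for c s
    proof -
      have "z - \<zeta> s \<noteq> 0" using Suc.prems that by auto
      have "((\<lambda>z. (z - \<zeta> s) ^ Suc n) has_field_derivative of_nat (Suc n) * (z - \<zeta> s) ^ n) (at z)"
        by (rule derivative_eq_intros refl | simp del: power_Suc)+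
      from DERIV_divide[OF DERIV_const this, of c] \<open>z - \<zeta> s \<noteq> 0\<close> show ?thesis
        by (simp add: divide_simps del: of_nat_Suc) (simp add: field_simps)
    qed
    then have "((\<lambda>z. (\<Sum>s\<in>S. (a s * (- 1) ^ n * fact n) / (z - \<zeta> s) ^ Suc n)) has_field_derivative
        (\<Sum>s\<in>S. - of_nat (Suc n) * (a s * (- 1) ^ n * fact n) / (z - \<zeta> s) ^ Suc (Suc n))) (at z)"
      by (intro DERIV_sum) 
    moreover have "(\<Sum>s\<in>S. - of_nat (Suc n) * (a s * (- 1) ^ n * fact n) / (z - \<zeta> s) ^ Suc (Suc n)) =
      (\<Sum>s\<in>S. a s * (- 1) ^ Suc n * fact (Suc n) / (z - \<zeta> s) ^ Suc (Suc n))"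
      by (intro sum.cong) (auto simp: field_simps)
    ultimately show "(?h has_field_derivative (\<Sum>s\<in>S. a s * (- 1) ^ Suc n * fact (Suc n) / (z - \<zeta> s) ^ Suc (Suc n)) + poly ((pderiv ^^ Suc n) P) z) (at z)"
      by (intro DERIV_add) (auto intro: poly_DERIV)
  qed
  finally show ?case by simp
qed

text \<open>One step of the recursion for c / (z - w): \<open>A\<close> and \<open>B\<close> stand
  for w minus the first and w minus the last node, \<open>N\<close> for the product over the inner
  nodes, so \<open>A - B\<close> is the last node minus the first.\<close>

lemma partial_fraction:
  fixes A B N c :: "'a :: field"
  assumes "A \<noteq> 0" "B \<noteq> 0" "N \<noteq> 0" "A \<noteq> B"
  shows "(- c / (B * N) - - c / (A * N)) / (A - B) = - c / (A * (B * N))"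
proof -
  have "- c / (B * N) - - c / (A * N) = - c * (A - B) / (A * (B * N))"
    using assms by (simp add: divide_simps) (simp add: algebra_simps)
  then show ?thesis using assms by simp
qed

text \<open>For distinct end points each pole term reproduces itself by the partial fraction
  identity; for coincident ones the formula is the higher derivative of 1 / (z - w). The polynomial
  part is carried along unevaluated and is killed later by its degree.\<close>

lemma divided_difference_rational:
  fixes f :: "complex \<Rightarrow> complex"
  assumes f: "\<And>z. z \<notin> \<zeta> ` S \<Longrightarrow> f z = (\<Sum>s\<in>S. a s / (z - \<zeta> s)) + poly P z"
    and S: "finite S"
    and "\<And>j. m \<le> j \<Longrightarrow> j \<le> m + d \<Longrightarrow> x j \<notin> \<zeta> ` S"
    and "equal_points_adjacent x m (m + d)"
  shows "divided_difference f x m d = (\<Sum>s\<in>S. - a s / node_poly x m (m + d) (\<zeta> s)) + divided_difference (poly P) x m d"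
  using assms(3,4)
proof (induction d arbitrary: m)
  case 0
  have "a s / (x m - \<zeta> s) = - a s / (\<zeta> s - x m)" for s
    by (metis minus_diff_eq minus_divide_right minus_divide_left)
  then show ?case using f[of "x m"] 0(1)[of m] by (simp add: node_poly_def)
next
  case (Suc d)
  let ?D = "divided_difference (poly P) x"
  show ?case
  proof (cases "x (m + Suc d) = x m")
    case True
    have eq: "x j = x m" if "m \<le> j" "j \<le> m + Suc d" for j
      using equal_points_adjacentD[OF Suc.prems(2) _ that] True by simp
    have np: "node_poly x m (m + Suc d) w = (w - x m) ^ Suc (Suc d)" for w
    proof -
      have "node_poly x m (m + Suc d) w = (\<Prod>r=m..m + Suc d. w - x m)"
        unfolding node_poly_def by (intro prod.cong refl) (metis eq atLeastAtMost_iff)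
      then show ?thesis by simp
    qed
    have dP: "poly ((pderiv ^^ Suc d) P) (x m) / fact (Suc d) = ?D m (Suc d)"
      unfolding higher_deriv_poly[symmetric]
      by (rule divided_difference_coincident[symmetric], rule eq)
    have sum: "(\<Sum>s\<in>S. a s * (- 1) ^ Suc d * fact (Suc d) / (x m - \<zeta> s) ^ Suc (Suc d)) / fact (Suc d)
        = (\<Sum>s\<in>S. - a s / node_poly x m (m + Suc d) (\<zeta> s))"
      unfolding sum_divide_distrib
    proof (intro sum.cong refl)
      fix s assume "s \<in> S"
      have "(\<zeta> s - x m) ^ Suc (Suc d) = (- 1) ^ Suc (Suc d) * (x m - \<zeta> s) ^ Suc (Suc d)"
        by (metis minus_diff_eq mult_minus1 power_mult_distrib)
      then show "a s * (- 1) ^ Suc d * fact (Suc d) / (x m - \<zeta> s) ^ Suc (Suc d) / fact (Suc d)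
          = - a s / node_poly x m (m + Suc d) (\<zeta> s)"
        unfolding np by (cases "even d") (simp_all del: power_Suc fact_Suc)
    qed
    have "divided_difference f x m (Suc d) = (deriv ^^ Suc d) f (x m) / fact (Suc d)"
      using True by simp
    moreover have "(deriv ^^ Suc d) f (x m) =
        (\<Sum>s\<in>S. a s * (- 1) ^ Suc d * fact (Suc d) / (x m - \<zeta> s) ^ Suc (Suc d)) + poly ((pderiv ^^ Suc d) P) (x m)"
      by (rule higher_deriv_rational, rule f, assumption, rule S, rule Suc.prems(1)) auto
    ultimately show ?thesis by (simp only: add_divide_distrib dP sum)
  next
    case False
    let ?b = "x (m + Suc d)"
    have 1: "divided_difference f x m d = (\<Sum>s\<in>S. - a s / node_poly x m (m + d) (\<zeta> s)) + ?D m d"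
      by (rule Suc.IH, rule Suc.prems(1)) (auto intro: equal_points_adjacent_subinterval[OF Suc.prems(2)])
    have 2: "divided_difference f x (Suc m) d = (\<Sum>s\<in>S. - a s / node_poly x (Suc m) (Suc m + d) (\<zeta> s)) + ?D (Suc m) d"
      by (rule Suc.IH, rule Suc.prems(1)) (auto intro: equal_points_adjacent_subinterval[OF Suc.prems(2)])
    have dP: "(?D (Suc m) d - ?D m d) / (?b - x m) = ?D m (Suc d)" using False by simp
    have sum: "(\<Sum>s\<in>S. (- a s / node_poly x (Suc m) (Suc m + d) (\<zeta> s) - - a s / node_poly x m (m + d) (\<zeta> s)) / (?b - x m))
        = (\<Sum>s\<in>S. - a s / node_poly x m (m + Suc d) (\<zeta> s))"
    proof (intro sum.cong refl)
      fix s assume s: "s \<in> S"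
      let ?w = "\<zeta> s" and ?N = "node_poly x (Suc m) (m + d) (\<zeta> s)"
      have nz: "?w - x j \<noteq> 0" if "m \<le> j" "j \<le> m + Suc d" for j
        using Suc.prems(1)[OF that] s by (metis eq_iff_diff_eq_0 imageI)
      have N: "?N \<noteq> 0" unfolding node_poly_def by (subst prod_zero_iff) (use nz in force)+
      have "{m..m + Suc d} = insert m (insert (m + Suc d) {Suc m..m + d})"
        "{Suc m..Suc m + d} = insert (m + Suc d) {Suc m..m + d}" "{m..m + d} = insert m {Suc m..m + d}" by auto
      then have "node_poly x (Suc m) (Suc m + d) ?w = (?w - ?b) * ?N"
        "node_poly x m (m + d) ?w = (?w - x m) * ?N"
        "node_poly x m (m + Suc d) ?w = (?w - x m) * ((?w - ?b) * ?N)"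
        unfolding node_poly_def by (simp_all)
      then show "(- a s / node_poly x (Suc m) (Suc m + d) ?w - - a s / node_poly x m (m + d) ?w) / (?b - x m)
          = - a s / node_poly x m (m + Suc d) ?w"
        using partial_fraction[of "?w - x m" "?w - ?b" ?N "a s"] N nz[of m] nz[of "m + Suc d"] False by simp
    qed
    have "divided_difference f x m (Suc d) = (divided_difference f x (Suc m) d - divided_difference f x m d) / (?b - x m)"
      using False by simp
    also have "\<dots> = (\<Sum>s\<in>S. (- a s / node_poly x (Suc m) (Suc m + d) (\<zeta> s) - - a s / node_poly x m (m + d) (\<zeta> s)) / (?b - x m))
        + (?D (Suc m) d - ?D m d) / (?b - x m)"
      unfolding 1 2
      by (simp only: sum_divide_distrib[symmetric] sum_subtractf add_divide_distrib[symmetric] add_diff_add[symmetric])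
    finally show ?thesis unfolding sum dP .
  qed
qed

section \<open>Lagrange interpolation and discrete orthogonality\<close>

text \<open>An arbitrary index set is allowed because initial segments and tails of the
  interpolation points, as well as sets of poles, are all needed as polynomials with a degree and a
  leading coefficient.\<close>

definition root_poly :: "(nat \<Rightarrow> complex) \<Rightarrow> nat set \<Rightarrow> complex poly" where
  "root_poly \<zeta> I = (\<Prod>i\<in>I. [:- \<zeta> i, 1:])"

lemma poly_root_poly: "poly (root_poly \<zeta> I) z = (\<Prod>i\<in>I. z - \<zeta> i)"
  by (simp add: root_poly_def poly_prod)

lemma poly_root_poly_interval: "poly (root_poly x {m..n}) z = node_poly x m n z"
  by (simp add: poly_root_poly node_poly_def)

lemma degree_root_poly: "degree (root_poly \<zeta> I) = card I"
  unfolding root_poly_def by (subst degree_prod_eq_sum_degree) auto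

lemma lead_coeff_root_poly: "lead_coeff (root_poly \<zeta> I) = 1"
  unfolding root_poly_def by (simp add: lead_coeff_prod)

lemma coeff_root_poly_card: "poly.coeff (root_poly \<zeta> I) (card I) = 1"
  using lead_coeff_root_poly[of \<zeta> I] by (simp add: degree_root_poly)

lemma root_poly_nonzero: "root_poly \<zeta> I \<noteq> 0"
  using lead_coeff_root_poly[of \<zeta> I] by auto

definition lagrange_basis :: "(nat \<Rightarrow> complex) \<Rightarrow> nat set \<Rightarrow> nat \<Rightarrow> complex poly" where
  "lagrange_basis \<zeta> I m = smult (1 / (\<Prod>i\<in>I - {m}. \<zeta> m - \<zeta> i)) (root_poly \<zeta> (I - {m}))"

lemma poly_lagrange_basis:
  "poly (lagrange_basis \<zeta> I m) z = (\<Prod>i\<in>I - {m}. (z - \<zeta> i) / (\<zeta> m - \<zeta> i))"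
  by (simp add: lagrange_basis_def poly_root_poly prod_dividef)

lemma degree_lagrange_basis:
  assumes "finite I" "m \<in> I"
  shows "degree (lagrange_basis \<zeta> I m) < card I"
proof -
  have "degree (lagrange_basis \<zeta> I m) \<le> card (I - {m})"
    unfolding lagrange_basis_def by (metis degree_root_poly degree_smult_le)
  then show ?thesis using assms card_Diff1_less[OF assms] by simp
qed

lemma poly_lagrange_basis_node:
  assumes "finite I" "inj_on \<zeta> I" "m \<in> I" "l \<in> I"
  shows "poly (lagrange_basis \<zeta> I m) (\<zeta> l) = (if l = m then 1 else 0)"
proof (cases "l = m")
  case True
  have "(\<zeta> m - \<zeta> i) / (\<zeta> m - \<zeta> i) = 1" if "i \<in> I - {m}" for i
    using inj_onD[OF assms(2), of m i] assms(3) that by auto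
  then show ?thesis using True by (simp add: poly_lagrange_basis)
next
  case False
  then have "l \<in> I - {m}" using assms by auto
  then show ?thesis using False assms(1) by (auto simp: poly_lagrange_basis intro!: prod_zero)
qed

text \<open>Two polynomials of degree at most n with the same n-th coefficient and the same values
  at n points are equal. The degree may exceed that of ordinary interpolation by one because the
  denominator V has degree k and is interpolated at only k poles.\<close>

lemma lagrange_interpolation:
  assumes "finite I" "inj_on \<zeta> I" "degree P \<le> card I"
  shows "P = smult (poly.coeff P (card I)) (root_poly \<zeta> I)
           + (\<Sum>m\<in>I. smult (poly P (\<zeta> m)) (lagrange_basis \<zeta> I m))" (is "_ = ?Q")
proof (rule poly_eqI_degree_lead_coeff[where n = "card I" and A = "\<zeta> ` I"])
  have small: "degree (\<Sum>m\<in>I. smult (poly P (\<zeta> m)) (lagrange_basis \<zeta> I m)) \<le> card I"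
    by (intro degree_sum_le assms(1) order_trans[OF degree_smult_le])
       (use degree_lagrange_basis[OF assms(1)] less_imp_le in blast)
  then show "degree ?Q \<le> card I"
    by (intro degree_add_le order_trans[OF degree_smult_le]) (simp_all add: degree_root_poly)
  have "poly.coeff (lagrange_basis \<zeta> I m) (card I) = 0" if "m \<in> I" for m
    by (rule coeff_eq_0, rule degree_lagrange_basis[OF assms(1) that])
  then show "poly.coeff P (card I) = poly.coeff ?Q (card I)"
    by (simp add: coeff_sum coeff_root_poly_card)
  show "card (\<zeta> ` I) \<ge> card I" by (simp add: card_image assms(2))
  show "degree P \<le> card I" by fact
  fix z assume "z \<in> \<zeta> ` I"
  then obtain l where l: "l \<in> I" "z = \<zeta> l" by auto
  have "poly (root_poly \<zeta> I) z = 0"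
    using l assms(1) by (auto simp: poly_root_poly intro!: prod_zero)
  moreover have "(\<Sum>m\<in>I. poly P (\<zeta> m) * poly (lagrange_basis \<zeta> I m) z) = (\<Sum>m\<in>I. if m = l then poly P z else 0)"
    by (intro sum.cong refl) (use l poly_lagrange_basis_node[OF assms(1,2) _ l(1)] in auto)
  ultimately show "poly P z = poly ?Q z"
    using l assms(1) by (simp add: poly_sum)
qed

lemma lagrange_evaluation:
  assumes "finite I" "inj_on \<zeta> I" "degree P < card I"
  shows "poly P z = (\<Sum>m\<in>I. poly P (\<zeta> m) * poly (lagrange_basis \<zeta> I m) z)"
  by (subst lagrange_interpolation[OF assms(1,2) less_imp_le[OF assms(3)]])
     (simp add: poly_sum coeff_eq_0 assms(3))

text \<open>Polynomials of every degree below n form a basis: subtracting the multiple of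
  \<open>b\<close> that cancels the leading term of \<open>h\<close> lowers the degree.\<close>

lemma point_functional_eq_0:
  fixes c :: "'i \<Rightarrow> complex"
  assumes "\<And>d. d < n \<Longrightarrow> \<exists>b. b \<noteq> 0 \<and> degree b = d \<and> (\<Sum>s\<in>S. c s * poly b (\<zeta> s)) = 0"
    and "degree h < n"
  shows "(\<Sum>s\<in>S. c s * poly h (\<zeta> s)) = 0"
  using assms(2)
proof (induction "degree h" arbitrary: h rule: less_induct)
  case less
  obtain b where b: "b \<noteq> 0" "degree b = degree h" "(\<Sum>s\<in>S. c s * poly b (\<zeta> s)) = 0"
    using assms(1)[OF less.prems] by blast
  let ?a = "lead_coeff h / lead_coeff b"
  let ?g = "h - smult ?a b"
  have lc: "poly.coeff ?g (degree h) = 0" using b(1) by (simp add: b(2)[symmetric])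
  have "degree ?g \<le> degree h"
    using b(2) degree_smult_le[of ?a b] by (intro degree_diff_le) auto
  then have "?g = 0 \<or> degree ?g < degree h" using lc by (rule eq_zero_or_degree_less)
  then have "(\<Sum>s\<in>S. c s * poly ?g (\<zeta> s)) = 0"
  proof
    assume "?g = 0"
    then show ?thesis by (simp only: poly_0 mult_zero_right sum.neutral_const)
  next
    assume "degree ?g < degree h"
    then show ?thesis using less.prems by (intro less.hyps) auto
  qed
  then have "(\<Sum>s\<in>S. c s * poly h (\<zeta> s)) - ?a * (\<Sum>s\<in>S. c s * poly b (\<zeta> s)) = 0"
    by (simp add: algebra_simps sum_subtractf sum_distrib_left)
  then show ?case using b by simp
qed

text \<open>The degrees are staggered, so the top coefficient isolates the last
  \<open>c j\<close>.\<close>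

lemma root_poly_initial_independent:
  assumes "(\<Sum>j<n. smult (c j) (root_poly x {1..j})) = 0" "j < n"
  shows "c j = 0"
  using assms
proof (induction n)
  case (Suc n)
  have "poly.coeff (\<Sum>j<n. smult (c j) (root_poly x {1..j})) n = 0"
    by (simp add: coeff_sum coeff_eq_0 degree_root_poly)
  moreover have "poly.coeff (root_poly x {1..n}) n = 1"
    using coeff_root_poly_card[of x "{1..n}"] by simp
  ultimately have "c n = 0"
    using arg_cong[OF Suc.prems(1), of "\<lambda>p. poly.coeff p n"] by simp
  then show ?case using Suc by (auto simp: less_Suc_eq)
qed simp

lemma root_poly_initial_combination:
  shows degree_root_poly_initial_combination: "degree (\<Sum>j\<le>k. smult (c j) (root_poly x {1..j})) \<le> k"
    and coeff_root_poly_initial_combination: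
      "poly.coeff (\<Sum>j\<le>k. smult (c j) (root_poly x {1..j})) k = c k"
proof -
  let ?P = "\<Sum>j\<le>k. smult (c j) (root_poly x {1..j})"
  show "degree ?P \<le> k"
    by (intro degree_sum_le) (auto intro!: order_trans[OF degree_smult_le] simp: degree_root_poly)
  have "?P = (\<Sum>j<k. smult (c j) (root_poly x {1..j})) + smult (c k) (root_poly x {1..k})"
    by (simp add: lessThan_Suc_atMost[symmetric])
  moreover have "poly.coeff (\<Sum>j<k. smult (c j) (root_poly x {1..j})) k = 0"
    by (simp add: coeff_sum coeff_eq_0 degree_root_poly)
  moreover have "poly.coeff (root_poly x {1..k}) k = 1"
    using coeff_root_poly_card[of x "{1..k}"] by simp
  ultimately show "poly.coeff ?P k = c k" by simp
qed

text \<open>Testing against the Lagrange polynomial of node m leaves a single term of the sum over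
  \<open>I\<close>, and the relation is solved for it. In the application \<open>I\<close> numbers
  the k inner poles, \<open>J\<close> the outer ones, and \<open>e s\<close> is Psi_p(z_s).\<close>

lemma orthogonal_value_at_node:
  assumes "finite I" "finite J" "I \<inter> J = {}" "inj_on \<zeta> I"
    and orth: "\<And>h. degree h < card I \<Longrightarrow> (\<Sum>s\<in>I \<union> J. a s * poly P (\<zeta> s) * poly h (\<zeta> s) / e s) = 0"
    and m: "m \<in> I" "a m \<noteq> 0" "e m \<noteq> 0"
  shows "poly P (\<zeta> m) = - (\<Sum>s\<in>J. a s / a m * poly (lagrange_basis \<zeta> I m) (\<zeta> s) * (e m / e s) * poly P (\<zeta> s))"
proof -
  let ?l = "\<lambda>s. poly (lagrange_basis \<zeta> I m) (\<zeta> s)"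
  have "(\<Sum>s\<in>I. a s * poly P (\<zeta> s) * ?l s / e s) = (\<Sum>s\<in>I. if s = m then a m * poly P (\<zeta> m) / e m else 0)"
    by (intro sum.cong refl) (use poly_lagrange_basis_node[OF assms(1,4) m(1)] in auto)
  also have "\<dots> = a m * poly P (\<zeta> m) / e m" using assms(1) m(1) by simp
  finally have "a m * poly P (\<zeta> m) / e m + (\<Sum>s\<in>J. a s * poly P (\<zeta> s) * ?l s / e s) = 0"
    using orth[OF degree_lagrange_basis[OF assms(1) m(1), of \<zeta>]] by (simp add: sum.union_disjoint assms(1-3))
  then have "a m * poly P (\<zeta> m) / e m = - (\<Sum>s\<in>J. a s * poly P (\<zeta> s) * ?l s / e s)"
    by (simp add: add_eq_0_iff2)
  then have "poly P (\<zeta> m) = e m / a m * - (\<Sum>s\<in>J. a s * poly P (\<zeta> s) * ?l s / e s)"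
    using m by (simp add: field_simps)
  then show ?thesis by (simp add: sum_distrib_left mult_ac)
qed

text \<open>A closed loop of estimates. With c the modulus of the leading coefficient and Y the sum
  of the inner values, interpolation bounds each outer value by M (c + Y), and orthogonality then
  gives Y <= M^2 \<eta> (c + Y); the smallness of \<eta> absorbs Y on the left. The case c = 0
  yields uniqueness, c = 1 yields decay.\<close>

lemma orthogonal_node_values_bound:
  assumes fin: "finite I" "finite J" and disj: "I \<inter> J = {}" and inj: "inj_on \<zeta> I"
    and deg: "degree P \<le> card I"
    and orth: "\<And>h. degree h < card I \<Longrightarrow> (\<Sum>s\<in>I \<union> J. a s * poly P (\<zeta> s) * poly h (\<zeta> s) / e s) = 0"
    and nz: "\<And>m. m \<in> I \<Longrightarrow> a m \<noteq> 0" "\<And>m. m \<in> I \<Longrightarrow> e m \<noteq> 0"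
    and M: "\<And>m s. m \<in> I \<Longrightarrow> s \<in> J \<Longrightarrow> cmod (a s / a m * poly (lagrange_basis \<zeta> I m) (\<zeta> s)) \<le> M"
      "\<And>m s. m \<in> I \<Longrightarrow> s \<in> J \<Longrightarrow> cmod (poly (lagrange_basis \<zeta> I m) (\<zeta> s)) \<le> M"
      "\<And>s. s \<in> J \<Longrightarrow> cmod (poly (root_poly \<zeta> I) (\<zeta> s)) \<le> M" and "M \<ge> 0"
    and \<eta>: "\<eta> = (\<Sum>m\<in>I. \<Sum>s\<in>J. cmod (e m / e s))" "M * M * \<eta> \<le> 1 / 2"
  shows "(\<Sum>m\<in>I. cmod (poly P (\<zeta> m))) \<le> 2 * M * M * \<eta> * cmod (poly.coeff P (card I))"
proof -
  let ?c = "cmod (poly.coeff P (card I))" and ?Y = "\<Sum>m\<in>I. cmod (poly P (\<zeta> m))"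
  have Y: "?Y \<ge> 0" by (simp add: sum_nonneg)
  have outer: "cmod (poly P (\<zeta> s)) \<le> M * (?c + ?Y)" if s: "s \<in> J" for s
  proof -
    have "poly P (\<zeta> s) = poly.coeff P (card I) * poly (root_poly \<zeta> I) (\<zeta> s)
        + (\<Sum>m\<in>I. poly P (\<zeta> m) * poly (lagrange_basis \<zeta> I m) (\<zeta> s))"
      by (subst lagrange_interpolation[OF fin(1) inj deg]) (simp add: poly_sum)
    also have "cmod \<dots> \<le> ?c * M + (\<Sum>m\<in>I. cmod (poly P (\<zeta> m)) * M)"
      by (intro norm_triangle_mono order_trans[OF norm_sum] sum_mono)
         (auto simp: norm_mult intro!: mult_left_mono M s)
    finally show ?thesis by (simp add: algebra_simps sum_distrib_left)
  qed
  have "cmod (poly P (\<zeta> m)) \<le> (\<Sum>s\<in>J. M * cmod (e m / e s) * (M * (?c + ?Y)))" if m: "m \<in> I" for m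
  proof -
    have "cmod (poly P (\<zeta> m)) =
      cmod (\<Sum>s\<in>J. a s / a m * poly (lagrange_basis \<zeta> I m) (\<zeta> s) * (e m / e s) * poly P (\<zeta> s))"
      by (subst orthogonal_value_at_node[OF fin disj inj orth m nz[OF m]]) (simp_all add: norm_minus_cancel)
    also have "\<dots> \<le> (\<Sum>s\<in>J. M * cmod (e m / e s) * (M * (?c + ?Y)))"
    proof (intro order_trans[OF norm_sum] sum_mono)
      fix s assume s: "s \<in> J"
      show "cmod (a s / a m * poly (lagrange_basis \<zeta> I m) (\<zeta> s) * (e m / e s) * poly P (\<zeta> s))
          \<le> M * cmod (e m / e s) * (M * (?c + ?Y))"
        unfolding norm_mult[of _ "poly P (\<zeta> s)"] norm_mult[of _ "e m / e s"]
        by (intro mult_mono M(1) outer s m order_refl mult_nonneg_nonneg norm_ge_zero \<open>M \<ge> 0\<close>)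
    qed
    finally show ?thesis .
  qed
  then have "?Y \<le> (\<Sum>m\<in>I. \<Sum>s\<in>J. M * cmod (e m / e s) * (M * (?c + ?Y)))" by (rule sum_mono)
  also have "\<dots> = M * M * \<eta> * (?c + ?Y)"
    unfolding \<eta>(1) by (simp add: sum_distrib_left sum_distrib_right mult_ac)
  also have "\<dots> \<le> M * M * \<eta> * ?c + 1 / 2 * ?Y"
    using mult_right_mono[OF \<eta>(2) Y] by (simp add: algebra_simps)
  finally show ?thesis by simp
qed

section \<open>Zeros of monic polynomials with small values at given points\<close>

lemma monic_root_near:
  fixes P :: "complex poly"
  assumes "lead_coeff P = 1" "cmod (poly P w) < \<delta> ^ degree P" "\<delta> > 0"
  shows "\<exists>z. poly P z = 0 \<and> dist w z < \<delta>"
proof (rule ccontr)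
  assume "\<not> ?thesis"
  then have far: "cmod (w - z) \<ge> \<delta>" if "poly P z = 0" for z
    using that by (force simp: dist_norm)
  have "P \<noteq> 0" using assms(1) by auto
  then obtain A where A: "size A = degree P" "P = (\<Prod>x\<in>#A. [:- x, 1:])"
    using alg_closed_imp_factorization[of P] assms(1) by auto
  have P: "poly P u = (\<Prod>x\<in>#A. u - x)" for u
    unfolding A(2) by (induction A) (auto simp: algebra_simps)
  \<comment> \<open>The modulus of \<open>poly P w\<close> is the product of the distances from
    \<open>w\<close> to the roots with multiplicity. Stated for any multiset \<open>B\<close> so
    that induction applies.\<close>
  have "\<delta> ^ size B \<le> cmod (\<Prod>x\<in>#B. w - x)" if "\<And>x. x \<in># B \<Longrightarrow> cmod (w - x) \<ge> \<delta>" for B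
    using that
  proof (induction B)
    case (add x B)
    then show ?case using assms(3) by (auto simp: norm_mult intro!: mult_mono)
  qed simp
  from this[of A] have "\<delta> ^ degree P \<le> cmod (poly P w)"
    using far A(1) by (auto simp: P prod_mset_zero_iff)
  then show False using assms(2) by simp
qed

text \<open>Small values at \<zeta> m force a zero nearby. The limits are distinct, so the k chosen
  zeros are eventually distinct and exhaust the zeros of a monic polynomial of degree k.\<close>

lemma labelled_zeros_exist:
  assumes inj: "inj_on \<zeta> {1..k}" and k: "k \<ge> 1"
    and V: "\<forall>\<^sub>F p in sequentially. degree (P p) = k \<and> poly.coeff (P p) k = 1 \<and> V p = poly (P p)"
    and lim: "\<And>m. m \<in> {1..k} \<Longrightarrow> (\<lambda>p. poly (P p) (\<zeta> m)) \<longlonglongrightarrow> 0"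
  shows "\<exists>zp. labelled_zeros V k \<zeta> zp"
proof -
  define Z where "Z p = {z. poly (P p) z = 0}" for p
  \<comment> \<open>The zero nearest to \<open>\<zeta> m\<close>; the choice is meaningful only once
    \<open>P p\<close> has degree \<open>k\<close>, which suffices for the limit.\<close>
  define zp where "zp p m = arg_min_on (dist (\<zeta> m)) (Z p)" for p m
  have zp: "poly (P p) (zp p m) = 0 \<and> (\<forall>z. poly (P p) z = 0 \<longrightarrow> dist (\<zeta> m) (zp p m) \<le> dist (\<zeta> m) z)"
    if "degree (P p) = k" for p m
  proof -
    have "P p \<noteq> 0" using that k by auto
    then have "finite (Z p)" unfolding Z_def by (rule poly_roots_finite)
    moreover have "Z p \<noteq> {}"
      using fundamental_theorem_of_algebra[of "P p"] that k constant_degree[of "P p"]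
      unfolding Z_def by auto
    ultimately show ?thesis
      using arg_min_if_finite[of "Z p" "dist (\<zeta> m)"] unfolding zp_def Z_def by force
  qed
  have lim_zp: "(\<lambda>p. zp p m) \<longlonglongrightarrow> \<zeta> m" if m: "m \<in> {1..k}" for m
  proof (rule tendstoI)
    fix \<epsilon> :: real assume \<epsilon>: "\<epsilon> > 0"
    have "\<forall>\<^sub>F p in sequentially. dist (poly (P p) (\<zeta> m)) 0 < \<epsilon> ^ k"
      using lim[OF m] \<epsilon> by (intro tendstoD) auto
    then show "\<forall>\<^sub>F p in sequentially. dist (zp p m) (\<zeta> m) < \<epsilon>"
      using V
    proof eventually_elim
      case (elim p)
      then obtain z where "poly (P p) z = 0" "dist (\<zeta> m) z < \<epsilon>"
        using monic_root_near[of "P p" "\<zeta> m" \<epsilon>] \<epsilon> by auto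
      then show ?case using zp[of p m] elim by (force simp: dist_commute)
    qed
  qed
  have "\<forall>\<^sub>F p in sequentially. \<forall>m\<in>{1..k}. \<forall>l\<in>{1..k}. m \<noteq> l \<longrightarrow> zp p m \<noteq> zp p l"
  proof (intro eventually_ball_finite ballI)
    fix m l assume ml: "m \<in> {1..k}" "l \<in> {1..k}"
    show "\<forall>\<^sub>F p in sequentially. m \<noteq> l \<longrightarrow> zp p m \<noteq> zp p l"
    proof (cases "m = l")
      case False
      then have "\<zeta> m - \<zeta> l \<noteq> 0" using inj ml by (auto dest: inj_onD)
      then have "\<forall>\<^sub>F p in sequentially. zp p m - zp p l \<noteq> 0"
        by (intro tendsto_imp_eventually_ne[OF tendsto_diff[OF lim_zp lim_zp]] ml) 
      then show ?thesis by eventually_elim auto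
    qed simp
  qed auto
  then have "\<forall>\<^sub>F p in sequentially. \<forall>z. V p z = (\<Prod>m=1..k. z - zp p m)"
    using V
  proof eventually_elim
    case (elim p)
    have "inj_on (zp p) {1..k}" using elim(1) by (auto simp: inj_on_def)
    then have "card (zp p ` {1..k}) = k" by (simp add: card_image)
    have "P p = root_poly (zp p) {1..k}"
    proof (rule poly_eqI_degree_lead_coeff[where n = k and A = "zp p ` {1..k}"])
      show "poly.coeff (P p) k = poly.coeff (root_poly (zp p) {1..k}) k"
        using elim coeff_root_poly_card[of "zp p" "{1..k}"] by simp
      fix z assume "z \<in> zp p ` {1..k}"
      then obtain m where "m \<in> {1..k}" "z = zp p m" by blast
      then have "(\<Prod>i=1..k. z - zp p i) = 0" by (intro prod_zero) auto
      then show "poly (P p) z = poly (root_poly (zp p) {1..k}) z"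
        using zp[of p m] elim(2) \<open>z = zp p m\<close> by (simp add: poly_root_poly)
    qed (use elim \<open>card (zp p ` {1..k}) = k\<close> in \<open>auto simp: degree_root_poly\<close>)
    then show ?case using elim by (simp add: poly_root_poly)
  qed
  then show ?thesis using lim_zp unfolding labelled_zeros_def by blast
qed

section \<open>The linear system and the determinants\<close>

lemma mat_mult_vec_index:
  assumes "i < k"
  shows "vec_index (Matrix.mat k k f *\<^sub>v Matrix.vec k c) i = (\<Sum>j<k. f (i, j) * c j)"
  using assms by (simp add: scalar_prod_def lessThan_atLeast0)

lemma det_mat_nonzero_iff:
  fixes f :: "nat \<times> nat \<Rightarrow> 'a :: field"
  shows "Determinant.det (Matrix.mat k k f) \<noteq> 0 \<longleftrightarrow>
    (\<forall>c. (\<forall>i<k. (\<Sum>j<k. f (i, j) * c j) = 0) \<longrightarrow> (\<forall>j<k. c j = 0))"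
proof -
  let ?A = "Matrix.mat k k f"
  have A: "?A \<in> carrier_mat k k" by simp
  have kernel: "?A *\<^sub>v Matrix.vec k c = 0\<^sub>v k \<longleftrightarrow> (\<forall>i<k. (\<Sum>j<k. f (i, j) * c j) = 0)" for c
  proof -
    have "?A *\<^sub>v Matrix.vec k c = 0\<^sub>v k \<longleftrightarrow> (\<forall>i<k. vec_index (?A *\<^sub>v Matrix.vec k c) i = 0)"
      by (auto simp: vec_eq_iff Matrix.vec_eq_iff)
    then show ?thesis by (simp only: mat_mult_vec_index cong: imp_cong)
  qed
  have zero: "Matrix.vec k c = 0\<^sub>v k \<longleftrightarrow> (\<forall>j<k. c j = 0)" for c :: "nat \<Rightarrow> 'a"
    by (auto simp: Matrix.vec_eq_iff)
  have "Determinant.det ?A = 0 \<longleftrightarrow> (\<exists>c. Matrix.vec k c \<noteq> 0\<^sub>v k \<and> ?A *\<^sub>v Matrix.vec k c = 0\<^sub>v k)"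
    unfolding det_0_iff_vec_prod_zero_field[OF A]
    by (metis carrier_vecD eq_vecI index_vec dim_vec vec_carrier)
  then show ?thesis unfolding kernel zero by blast
qed

lemma det_mat_nonzero_solvable:
  fixes f :: "nat \<times> nat \<Rightarrow> 'a :: field"
  assumes "Determinant.det (Matrix.mat k k f) \<noteq> 0"
  shows "\<exists>c. \<forall>i<k. (\<Sum>j<k. f (i, j) * c j) = b i"
proof -
  let ?A = "Matrix.mat k k f" and ?b = "Matrix.vec k b"
  have A: "?A \<in> carrier_mat k k" by simp
  \<comment> \<open>The adjugate gives A y = det(A) b, so y divided by the determinant solves the
    system.\<close>
  define y where "y = adj_mat ?A *\<^sub>v ?b"
  have y: "y \<in> carrier_vec k" unfolding y_def using adj_mat(1)[OF A] by auto
  have "?A *\<^sub>v y = (?A * adj_mat ?A) *\<^sub>v ?b"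
    unfolding y_def using adj_mat(1)[OF A] by (intro assoc_mult_mat_vec[symmetric]) auto
  also have "\<dots> = Determinant.det ?A \<cdot>\<^sub>v ?b"
    unfolding adj_mat(2)[OF A] by auto
  finally have Ay: "?A *\<^sub>v y = Determinant.det ?A \<cdot>\<^sub>v ?b" .
  have "y = Matrix.vec k (vec_index y)" using y by auto
  then have "(\<Sum>j<k. f (i, j) * vec_index y j) = Determinant.det ?A * b i" if "i < k" for i
    using that mat_mult_vec_index[OF that, of f "vec_index y"] Ay by simp
  then show ?thesis
    using assms by (intro exI[of _ "\<lambda>j. vec_index y j / Determinant.det ?A"])
      (simp add: sum_divide_distrib[symmetric])
qed

section \<open>The entries u of the linear system for rational F\<close>

lemma inner_product_sum_right:
  assumes "inner_product_on_Cn ip" "finite S"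
  shows "ip x (\<Sum>s\<in>S. c s *s v s) = (\<Sum>s\<in>S. c s * ip x (v s))"
proof -
  have add: "ip x (y + z) = ip x y + ip x z" and scale: "ip x (a *s y) = a * ip x y" for a y z
    using assms(1) unfolding inner_product_on_Cn_def by blast+
  have "ip x 0 = 0" using scale[of 0 0] by simp
  with assms(2) show ?thesis by (induction S) (simp_all add: add scale)
qed

lemma vector_divided_difference_rational:
  assumes F: "\<And>z. z \<notin> \<zeta> ` S \<Longrightarrow>
      F z = (\<Sum>s\<in>S. (1 / (z - \<zeta> s)) *s v s) + vec_lambda (\<lambda>i. poly (vec_nth U i) z)"
    and S: "finite S" and "m \<le> n"
    and x: "\<And>j. m \<le> j \<Longrightarrow> j \<le> n \<Longrightarrow> x j \<notin> \<zeta> ` S" "equal_points_adjacent x m n"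
    and deg: "\<And>i. degree (vec_nth U i) < n - m"
  shows "vector_divided_difference F x m n = (\<Sum>s\<in>S. (- 1 / node_poly x m n (\<zeta> s)) *s v s)"
proof -
  have n: "m + (n - m) = n" using \<open>m \<le> n\<close> by simp
  have "divided_difference (\<lambda>z. vec_nth (F z) i) x m (n - m) =
      (\<Sum>s\<in>S. - vec_nth (v s) i / node_poly x m n (\<zeta> s))" for i
  proof -
    have "divided_difference (\<lambda>z. vec_nth (F z) i) x m (n - m) =
      (\<Sum>s\<in>S. - vec_nth (v s) i / node_poly x m (m + (n - m)) (\<zeta> s))
      + divided_difference (poly (vec_nth U i)) x m (n - m)"
      by (rule divided_difference_rational[OF _ S]) (use x F in \<open>auto simp: n sum_component\<close>)
    also have "divided_difference (poly (vec_nth U i)) x m (n - m) = 0"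
      by (rule divided_difference_poly_eq_0) (use x deg in \<open>auto simp: n\<close>)
    finally show ?thesis by (simp add: n)
  qed
  then show ?thesis
    by (simp add: vector_divided_difference_def Finite_Cartesian_Product.vec_eq_iff sum_component)
qed

lemma node_poly_split:
  assumes "j \<le> p + i" "i \<le> k"
  shows "node_poly x 1 (p + k) z =
    node_poly x 1 j z * node_poly x (j + 1) (p + i) z * node_poly x (p + i + 1) (p + k) z"
proof -
  have "{1..p + k} = ({1..j} \<union> {j + 1..p + i}) \<union> {p + i + 1..p + k}" using assms by auto
  moreover have "({1..j} \<union> {j + 1..p + i}) \<inter> {p + i + 1..p + k} = {}" using assms by auto
  ultimately have "node_poly x 1 (p + k) z =
      (\<Prod>r\<in>{1..j} \<union> {j + 1..p + i}. z - x r) * (\<Prod>r\<in>{p + i + 1..p + k}. z - x r)"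
    unfolding node_poly_def by (metis prod.union_disjoint finite_UnI finite_atLeastAtMost)
  also have "(\<Prod>r\<in>{1..j} \<union> {j + 1..p + i}. z - x r) = node_poly x 1 j z * node_poly x (j + 1) (p + i) z"
    unfolding node_poly_def by (rule prod.union_disjoint) auto
  finally show ?thesis by (simp add: node_poly_def)
qed

text \<open>Each pole contributes 1 / psi_{j+1,p+i}(z_s). Multiplying numerator and denominator by
  the missing head and tail puts all entries over the common Psi_p(z_s); the column j then enters
  only through the head and the row i only through the tail.\<close>

lemma itea_u_rational:
  assumes ip: "inner_product_on_Cn ip"
    and F: "\<And>z. z \<notin> \<zeta> ` S \<Longrightarrow>
      F z = (\<Sum>s\<in>S. (1 / (z - \<zeta> s)) *s v s) + vec_lambda (\<lambda>i. poly (vec_nth U i) z)"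
    and S: "finite S"
    and x: "equal_points_adjacent x 1 (p + k)" "\<And>s. s \<in> S \<Longrightarrow> node_poly x 1 (p + k) (\<zeta> s) \<noteq> 0"
    and deg: "\<And>i. degree (vec_nth U i) + k < p"
    and ij: "i \<in> {1..k}" "j \<le> k"
  shows "itea_u ip q F x p i j = - (\<Sum>s\<in>S. ip q (v s) * node_poly x 1 j (\<zeta> s)
      * node_poly x (p + i + 1) (p + k) (\<zeta> s) / node_poly x 1 (p + k) (\<zeta> s))"
proof -
  \<comment> \<open>Any component index will do: the degree bound already contains
    \<open>k < p\<close>.\<close>
  have kp: "k < p" using deg[of undefined] by simp
  have "x l \<notin> \<zeta> ` S" if "j + 1 \<le> l" "l \<le> p + i" for l
  proof
    assume "x l \<in> \<zeta> ` S"
    then obtain s where s: "s \<in> S" "\<zeta> s = x l" by auto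
    have "node_poly x 1 (p + k) (\<zeta> s) = 0"
      unfolding node_poly_def by (rule prod_zero) (use that ij s in \<open>auto intro!: bexI[of _ l]\<close>)
    then show False using x(2) s by blast
  qed
  moreover have "equal_points_adjacent x (j + 1) (p + i)"
    by (rule equal_points_adjacent_subinterval[OF x(1)]) (use ij in auto)
  moreover have "degree (vec_nth U l) < p + i - (j + 1)" for l
    using deg[of l] ij by auto
  ultimately have "vector_divided_difference F x (j + 1) (p + i) =
      (\<Sum>s\<in>S. (- 1 / node_poly x (j + 1) (p + i) (\<zeta> s)) *s v s)"
    using kp ij by (intro vector_divided_difference_rational[OF F S]) auto
  then have "itea_u ip q F x p i j = (\<Sum>s\<in>S. - 1 / node_poly x (j + 1) (p + i) (\<zeta> s) * ip q (v s))"
    unfolding itea_u_def by (simp only: inner_product_sum_right[OF ip S])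
  also have "\<dots> = (\<Sum>s\<in>S. - (ip q (v s) * node_poly x 1 j (\<zeta> s)
      * node_poly x (p + i + 1) (p + k) (\<zeta> s) / node_poly x 1 (p + k) (\<zeta> s)))"
  proof (intro sum.cong refl)
    fix s assume s: "s \<in> S"
    have split: "node_poly x 1 (p + k) (\<zeta> s) =
        node_poly x 1 j (\<zeta> s) * node_poly x (j + 1) (p + i) (\<zeta> s) * node_poly x (p + i + 1) (p + k) (\<zeta> s)"
      using ij kp by (intro node_poly_split) auto
    show "- 1 / node_poly x (j + 1) (p + i) (\<zeta> s) * ip q (v s) = - (ip q (v s) * node_poly x 1 j (\<zeta> s)
      * node_poly x (p + i + 1) (p + k) (\<zeta> s) / node_poly x 1 (p + k) (\<zeta> s))"
      using x(2)[OF s] unfolding split by (simp add: field_simps)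
  qed
  finally show ?thesis by (simp add: sum_negf)
qed

text \<open>The tails \<open>\<psi>\<^sub>p\<^sub>+\<^sub>i\<^sub>+\<^sub>1\<^sub>,\<^sub>p\<^sub>+\<^sub>k\<close>, \<open>1 \<le> i \<le> k\<close>, have degrees \<open>k - 1, \<dots>, 0\<close> and hence span all
  polynomials of degree below \<open>k\<close>: the linear system says that \<open>V\<close> is orthogonal to these with
  respect to a discrete measure on the poles.\<close>

lemma itea_system_orthogonal:
  assumes ip: "inner_product_on_Cn ip"
    and F: "\<And>z. z \<notin> \<zeta> ` S \<Longrightarrow>
      F z = (\<Sum>s\<in>S. (1 / (z - \<zeta> s)) *s v s) + vec_lambda (\<lambda>i. poly (vec_nth U i) z)"
    and S: "finite S"
    and x: "equal_points_adjacent x 1 (p + k)" "\<And>s. s \<in> S \<Longrightarrow> node_poly x 1 (p + k) (\<zeta> s) \<noteq> 0"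
    and deg: "\<And>i. degree (vec_nth U i) + k < p"
    and c: "\<And>i. i \<in> {1..k} \<Longrightarrow> (\<Sum>j\<le>k. itea_u ip q F x p i j * c j) = 0"
    and h: "degree h < k"
  shows "(\<Sum>s\<in>S. ip q (v s) * poly (\<Sum>j\<le>k. smult (c j) (root_poly x {1..j})) (\<zeta> s) * poly h (\<zeta> s)
      / node_poly x 1 (p + k) (\<zeta> s)) = 0"
proof -
  let ?V = "\<Sum>j\<le>k. smult (c j) (root_poly x {1..j})" and ?e = "\<lambda>s. node_poly x 1 (p + k) (\<zeta> s)"
  have V: "poly ?V z = (\<Sum>j\<le>k. c j * node_poly x 1 j z)" for z
    by (simp add: poly_sum poly_root_poly_interval del: One_nat_def)
  have tail: "(\<Sum>s\<in>S. ip q (v s) * poly ?V (\<zeta> s) / ?e s * poly (root_poly x {p + i + 1..p + k}) (\<zeta> s)) = 0"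
    if i: "i \<in> {1..k}" for i
  proof -
    have "(\<Sum>s\<in>S. ip q (v s) * poly ?V (\<zeta> s) / ?e s * poly (root_poly x {p + i + 1..p + k}) (\<zeta> s)) =
        (\<Sum>s\<in>S. \<Sum>j\<le>k. ip q (v s) * node_poly x 1 j (\<zeta> s)
          * node_poly x (p + i + 1) (p + k) (\<zeta> s) / ?e s * c j)"
      by (intro sum.cong refl)
         (simp add: V poly_root_poly_interval sum_distrib_left sum_distrib_right sum_divide_distrib mult_ac del: One_nat_def)
    also have "\<dots> = (\<Sum>j\<le>k. - (itea_u ip q F x p i j * c j))"
      by (subst sum.swap, intro sum.cong refl, subst itea_u_rational[OF ip F S x deg i])
         (simp_all add: sum_distrib_right del: One_nat_def)
    also have "\<dots> = 0" using c[OF i] by (simp add: sum_negf)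
    finally show ?thesis .
  qed
  have "(\<Sum>s\<in>S. ip q (v s) * poly ?V (\<zeta> s) / ?e s * poly h (\<zeta> s)) = 0"
  proof (rule point_functional_eq_0[OF _ h])
    fix d assume d: "d < k"
    show "\<exists>b. b \<noteq> 0 \<and> degree b = d \<and> (\<Sum>s\<in>S. ip q (v s) * poly ?V (\<zeta> s) / ?e s * poly b (\<zeta> s)) = 0"
      \<comment> \<open>Row \<open>k - d\<close> supplies the tail with exactly \<open>d\<close>
        factors.\<close>
      by (intro exI[of _ "root_poly x {p + (k - d) + 1..p + k}"] conjI root_poly_nonzero tail)
         (use d in \<open>auto simp: degree_root_poly\<close>)
  qed
  then show ?thesis by (simp add: mult_ac)
qed

text \<open>A nonzero determinant gives existence and uniqueness, so the description by
  \<open>THE\<close> denotes the solution. Since \<open>c k = 1\<close>, the right-hand side can be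
  moved over as column k, which makes the system homogeneous over \<open>j \<le> k\<close>.\<close>

lemma itea_coeffs_solution:
  assumes "itea_det ip q F x p k \<noteq> 0"
  shows "itea_coeffs ip q F x p k k = 1"
    and "\<And>i. i \<in> {1..k} \<Longrightarrow> (\<Sum>j\<le>k. itea_u ip q F x p i j * itea_coeffs ip q F x p k j) = 0"
proof -
  let ?u = "itea_u ip q F x p"
  let ?sol = "\<lambda>c. (\<forall>j>k. c j = 0) \<and> c k = 1 \<and> (\<forall>i\<in>{1..k}. (\<Sum>j<k. ?u i j * c j) = - ?u i k)"
  have det: "Determinant.det (Matrix.mat k k (\<lambda>(i, j). ?u (i + 1) j)) \<noteq> 0"
    using assms unfolding itea_det_def .
  have shift: "(\<forall>i\<in>{1..k}. Q i) \<longleftrightarrow> (\<forall>i<k. Q (i + 1))" for Q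
  proof
    assume *: "\<forall>i<k. Q (i + 1)"
    show "\<forall>i\<in>{1..k}. Q i"
    proof
      fix i assume "i \<in> {1..k}"
      then show "Q i" using *[rule_format, of "i - 1"] by auto
    qed
  qed auto
  obtain b where b: "\<forall>i<k. (\<Sum>j<k. ?u (i + 1) j * b j) = - ?u (i + 1) k"
    using det_mat_nonzero_solvable[OF det, of "\<lambda>i. - ?u (i + 1) k"] by auto
  define c where "c j = (if j < k then b j else if j = k then 1 else 0)" for j
  have "?sol c" unfolding shift using b by (simp add: c_def)
  moreover have "d = c" if "?sol d" for d
  proof -
    have "(\<Sum>j<k. ?u i j * (d j - c j)) = 0" if "i \<in> {1..k}" for i
      using that \<open>?sol c\<close> \<open>?sol d\<close> by (simp add: right_diff_distrib sum_subtractf)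
    then have "\<forall>i<k. (\<Sum>j<k. ?u (i + 1) j * (d j - c j)) = 0" by auto
    then have "\<forall>j<k. d j - c j = 0"
      using det[unfolded det_mat_nonzero_iff, rule_format, of "\<lambda>j. d j - c j"] by simp
    then show ?thesis
      using \<open>?sol c\<close> \<open>?sol d\<close> by (intro ext) (metis linorder_neqE_nat right_minus_eq)
  qed
  ultimately have "?sol (itea_coeffs ip q F x p k)"
    unfolding itea_coeffs_def by (rule theI)
  then show "itea_coeffs ip q F x p k k = 1"
    and "\<And>i. i \<in> {1..k} \<Longrightarrow> (\<Sum>j\<le>k. ?u i j * itea_coeffs ip q F x p k j) = 0"
    by (simp_all add: lessThan_Suc_atMost[symmetric])
qed

lemma itea_denominator_eq_poly:
  "itea_denominator ip q F x p k =
    poly (\<Sum>j\<le>k. smult (itea_coeffs ip q F x p k j) (root_poly x {1..j}))"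
  by (rule ext) (simp only: itea_denominator_def poly_sum poly_smult poly_root_poly_interval atLeast0AtMost)

text \<open>A kernel vector, padded by \<open>c k = 0\<close>, solves the homogeneous system over
  \<open>j \<le> k\<close>. By independence of the psi_{1,j} it vanishes as soon as its polynomial
  does, so regularity becomes a statement about polynomials.\<close>

lemma itea_det_nonzeroI:
  assumes "\<And>c. c k = 0 \<Longrightarrow> (\<And>i. i \<in> {1..k} \<Longrightarrow> (\<Sum>j\<le>k. itea_u ip q F x p i j * c j) = 0) \<Longrightarrow>
      (\<Sum>j\<le>k. smult (c j) (root_poly x {1..j})) = 0"
  shows "itea_det ip q F x p k \<noteq> 0"
  unfolding itea_det_def det_mat_nonzero_iff
proof (intro allI impI)
  fix c j
  assume c: "\<forall>i<k. (\<Sum>j<k. (case (i, j) of (i, j) \<Rightarrow> itea_u ip q F x p (i + 1) j) * c j) = 0" and j: "j < k"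
  define d where "d j = (if j < k then c j else 0)" for j
  have "(\<Sum>j\<le>k. itea_u ip q F x p i j * d j) = 0" if "i \<in> {1..k}" for i
    using c[rule_format, of "i - 1"] that by (cases i) (auto simp: lessThan_Suc_atMost[symmetric] d_def)
  then have "(\<Sum>j\<le>k. smult (d j) (root_poly x {1..j})) = 0" by (intro assms) (auto simp: d_def)
  then have "(\<Sum>j<k. smult (d j) (root_poly x {1..j})) = 0"
    by (simp add: lessThan_Suc_atMost[symmetric] d_def)
  then have "d j = 0" using j by (rule root_poly_initial_independent)
  then show "c j = 0" using j by (simp add: d_def)
qed

text \<open>Lagrange interpolation expresses column \<open>k + 1\<close> through the columns \<open>1, \<dots>, k\<close>; Cramer's rule
  then evaluates the determinant in which it replaces column \<open>m\<close>. The sign moves the last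
  column to position \<open>m\<close>.\<close>

lemma itea_T_exchange:
  assumes m: "m \<in> {1..k}" and inj: "inj_on \<zeta> {1..k}"
    and nz: "\<And>i. i \<in> {1..k} \<Longrightarrow> ip q (v i) \<noteq> 0"
  shows "(- 1) ^ (k - m) * itea_T ip q v \<zeta> x p k ([1..<m] @ [m + 1..<k + 2]) =
    ip q (v (k + 1)) / ip q (v m) * poly (lagrange_basis \<zeta> {1..k} m) (\<zeta> (k + 1))
      * itea_T ip q v \<zeta> x p k [1..<k + 1]"
proof -
  let ?\<alpha> = "itea_alpha ip q v \<zeta> x p k" and ?l = "\<lambda>j. poly (lagrange_basis \<zeta> {1..k} j) (\<zeta> (k + 1))"
  let ?ss = "[1..<m] @ [m + 1..<k + 2]"
  \<comment> \<open>The coefficients of column k + 1 in terms of columns 1 to k, shifted to indices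
    from 0; they come from Lagrange evaluation of the tails, whose degrees are below k.\<close>
  define f where "f j = ip q (v (k + 1)) / ip q (v (j + 1)) * ?l (j + 1)" for j
  define A where "A = Matrix.mat k k (\<lambda>(i, j). ?\<alpha> (i + 1) (?ss ! j))"
  define B where "B = Matrix.mat k k (\<lambda>(i, j). ?\<alpha> (i + 1) (j + 1))"
  have T: "itea_T ip q v \<zeta> x p k [1..<k + 1] = Determinant.det B"
    unfolding itea_T_def B_def by (intro arg_cong[where f = Determinant.det] cong_mat) (auto simp del: upt_Suc)
  have col: "(\<Sum>j<k. ?\<alpha> (i + 1) (j + 1) * f j) = ?\<alpha> (i + 1) (k + 1)" if i: "i < k" for i
  proof -
    let ?h = "root_poly x {p + (i + 1) + 1..p + k}"
    have deg: "degree ?h < k" using i by (simp add: degree_root_poly)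
    have "poly ?h (\<zeta> (k + 1)) = (\<Sum>j\<in>{1..k}. poly ?h (\<zeta> j) * ?l j)"
      by (rule lagrange_evaluation[OF _ inj]) (use deg in auto)
    also have "\<dots> = (\<Sum>j<k. poly ?h (\<zeta> (j + 1)) * ?l (j + 1))"
      by (rule sum.reindex_bij_witness[of _ "\<lambda>j. j + 1" "\<lambda>j. j - 1"]) auto
    finally have "?\<alpha> (i + 1) (k + 1) = ip q (v (k + 1)) * (\<Sum>j<k. poly ?h (\<zeta> (j + 1)) * ?l (j + 1))"
      unfolding itea_alpha_def by (simp only: poly_root_poly_interval)
    also have "\<dots> = (\<Sum>j<k. ?\<alpha> (i + 1) (j + 1) * f j)"
      unfolding sum_distrib_left itea_alpha_def f_def
      by (intro sum.cong refl) (use nz in \<open>simp add: poly_root_poly_interval\<close>)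
    finally show ?thesis ..
  qed
  define R where "R = Matrix.mat k k (\<lambda>(i, j). if j = m - 1 then ?\<alpha> (i + 1) (k + 1) else ?\<alpha> (i + 1) (j + 1))"
  have B: "B \<in> carrier_mat k k" unfolding B_def by simp
  have "replace_col B (B *\<^sub>v Matrix.vec k f) (m - 1) = R"
    unfolding R_def replace_col_def
  proof (rule eq_matI)
    fix i j assume "i < dim_row (Matrix.mat k k (\<lambda>(i, j). if j = m - 1 then ?\<alpha> (i + 1) (k + 1) else ?\<alpha> (i + 1) (j + 1)))"
      "j < dim_col (Matrix.mat k k (\<lambda>(i, j). if j = m - 1 then ?\<alpha> (i + 1) (k + 1) else ?\<alpha> (i + 1) (j + 1)))"
    then have ij: "i < k" "j < k" by auto
    have "vec_index (B *\<^sub>v Matrix.vec k f) i = ?\<alpha> (i + 1) (k + 1)"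
      unfolding B_def mat_mult_vec_index[OF ij(1)] using col[OF ij(1)] by simp
    then show "Matrix.mat (dim_row B) (dim_col B)
         (\<lambda>(i, j). if j = m - 1 then vec_index (B *\<^sub>v Matrix.vec k f) i else B $$ (i, j)) $$ (i, j) =
        Matrix.mat k k (\<lambda>(i, j). if j = m - 1 then ?\<alpha> (i + 1) (k + 1) else ?\<alpha> (i + 1) (j + 1)) $$ (i, j)"
      using ij B unfolding B_def by simp
  qed (use B in auto)
  then have R: "Determinant.det R = f (m - 1) * Determinant.det B"
    using cramer_lemma_mat[OF B, of "Matrix.vec k f" "m - 1"] m by auto
  have A: "A \<in> carrier_mat k k" unfolding A_def by simp
  have ss: "?ss ! j = (if j < m - 1 then j + 1 else j + 2)" if "j < k" for j
    using that m by (auto simp: nth_append simp del: upt_Suc)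
  \<comment> \<open>The last column, belonging to pole k + 1, passes the k - m columns of the poles
    m + 1 to k.\<close>
  have "Determinant.det A = (- 1) ^ ((k - m) * 1) * Determinant.det (Matrix.mat k k
      (\<lambda>(i, j). A $$ (i, if j < m - 1 then j else if j < m - 1 + 1 then j + (k - m) else j - 1)))"
    by (rule det_swap_final_cols[OF A]) (use m in auto)
  also have "Matrix.mat k k
      (\<lambda>(i, j). A $$ (i, if j < m - 1 then j else if j < m - 1 + 1 then j + (k - m) else j - 1)) = R"
    unfolding R_def
  proof (rule cong_mat)
    fix i j assume ij: "i < k" "j < k"
    let ?j = "if j < m - 1 then j else if j < m - 1 + 1 then j + (k - m) else j - 1"
    have j: "?j < k" using ij m by auto
    have "A $$ (i, ?j) = ?\<alpha> (i + 1) (?ss ! ?j)" unfolding A_def using ij(1) j by simp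
    also have "?ss ! ?j = (if j = m - 1 then k + 1 else j + 1)"
      unfolding ss[OF j] using ij m by auto
    finally show "(case (i, j) of (i, j) \<Rightarrow> A $$ (i, if j < m - 1 then j else if j < m - 1 + 1 then j + (k - m) else j - 1)) =
        (case (i, j) of (i, j) \<Rightarrow> if j = m - 1 then ?\<alpha> (i + 1) (k + 1) else ?\<alpha> (i + 1) (j + 1))"
      by simp
  qed auto
  finally have "(- 1) ^ (k - m) * Determinant.det A = Determinant.det R"
    by (simp add: power_mult_distrib[symmetric] mult.assoc[symmetric])
  moreover have "itea_T ip q v \<zeta> x p k ?ss = Determinant.det A"
    unfolding itea_T_def A_def ..
  moreover have "f (m - 1) = ip q (v (k + 1)) / ip q (v m) * ?l m"
    using m by (simp add: f_def)
  ultimately show ?thesis by (simp only: T R)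
qed

section \<open>Asymptotics\<close>

text \<open>All that holds for a single p once the ratios Psi_p(z_m) / Psi_p(z_s) are small. The
  same bound serves twice: with \<open>c k = 0\<close> it gives regularity of the system, with
  \<open>c k = 1\<close> smallness of V at the inner poles.\<close>

lemma itea_estimates:
  fixes k \<mu> p :: nat and x \<zeta> :: "nat \<Rightarrow> complex" and q :: "complex ^ 'n" and v :: "nat \<Rightarrow> complex ^ 'n"
    and ip :: "complex ^ 'n \<Rightarrow> complex ^ 'n \<Rightarrow> complex" and F :: "complex \<Rightarrow> complex ^ 'n"
  defines "J \<equiv> {k + 1..\<mu>}" and "e \<equiv> \<lambda>s. node_poly x 1 (p + k) (\<zeta> s)" and "a \<equiv> \<lambda>s. ip q (v s)"
    and "P \<equiv> \<Sum>j\<le>k. smult (itea_coeffs ip q F x p k j) (root_poly x {1..j})"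
  assumes ip: "inner_product_on_Cn ip"
    and F: "\<And>z. z \<notin> \<zeta> ` {1..\<mu>} \<Longrightarrow>
      F z = (\<Sum>s=1..\<mu>. (1 / (z - \<zeta> s)) *s v s) + vec_lambda (\<lambda>i. poly (vec_nth U i) z)"
    and x: "equal_points_adjacent x 1 (p + k)" "\<And>s. s \<in> {1..\<mu>} \<Longrightarrow> e s \<noteq> 0"
    and deg: "\<And>i. degree (vec_nth U i) + k < p"
    and k: "k < \<mu>" and inj: "inj_on \<zeta> {1..\<mu>}" and nz: "\<And>m. m \<in> {1..k} \<Longrightarrow> a m \<noteq> 0"
    and M: "\<And>m s. m \<in> {1..k} \<Longrightarrow> s \<in> J \<Longrightarrow> cmod (a s / a m * poly (lagrange_basis \<zeta> {1..k} m) (\<zeta> s)) \<le> M"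
      "\<And>m s. m \<in> {1..k} \<Longrightarrow> s \<in> J \<Longrightarrow> cmod (poly (lagrange_basis \<zeta> {1..k} m) (\<zeta> s)) \<le> M"
      "\<And>s. s \<in> J \<Longrightarrow> cmod (poly (root_poly \<zeta> {1..k}) (\<zeta> s)) \<le> M" "M \<ge> 0"
    and \<eta>: "\<eta> = (\<Sum>m\<in>{1..k}. \<Sum>s\<in>J. cmod (e m / e s))" "M * M * \<eta> \<le> 1 / 2"
  shows "itea_det ip q F x p k \<noteq> 0"
    and "degree P = k" "poly.coeff P k = 1" "itea_denominator ip q F x p k = poly P"
    and "(\<Sum>m\<in>{1..k}. cmod (poly P (\<zeta> m))) \<le> 2 * M * M * \<eta>"
    and "\<And>m. m \<in> {1..k} \<Longrightarrow> poly P (\<zeta> m) =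
      - (\<Sum>s\<in>J. a s / a m * poly (lagrange_basis \<zeta> {1..k} m) (\<zeta> s) * (e m / e s) * poly P (\<zeta> s))"
proof -
  have sets: "finite {1..k}" "finite J" "{1..k} \<inter> J = {}" "inj_on \<zeta> {1..k}" "{1..k} \<union> J = {1..\<mu>}"
    using k inj unfolding J_def by (auto intro: inj_on_subset)
  have e_nz: "e m \<noteq> 0" if "m \<in> {1..k}" for m using x(2) that k by auto
  let ?Q = "\<lambda>c. \<Sum>j\<le>k. smult (c j) (root_poly x {1..j})"
  have orth: "(\<Sum>s\<in>{1..k} \<union> J. a s * poly (?Q c) (\<zeta> s) * poly h (\<zeta> s) / e s) = 0"
    if "\<And>i. i \<in> {1..k} \<Longrightarrow> (\<Sum>j\<le>k. itea_u ip q F x p i j * c j) = 0" "degree h < card {1..k}" for c h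
    unfolding sets(5) a_def e_def
    by (rule itea_system_orthogonal[where U = U and F = F]) (use ip F x deg that in \<open>simp_all add: e_def\<close>)
  have bound: "(\<Sum>m\<in>{1..k}. cmod (poly (?Q c) (\<zeta> m))) \<le> 2 * M * M * \<eta> * cmod (c k)"
    if "\<And>i. i \<in> {1..k} \<Longrightarrow> (\<Sum>j\<le>k. itea_u ip q F x p i j * c j) = 0" for c
  proof -
    have "(\<Sum>m\<in>{1..k}. cmod (poly (?Q c) (\<zeta> m))) \<le> 2 * M * M * \<eta> * cmod (poly.coeff (?Q c) (card {1..k}))"
      by (rule orthogonal_node_values_bound[where a = a and e = e and J = J])
         (use sets degree_root_poly_initial_combination[of c x k] orth[OF that] nz e_nz M \<eta> in simp_all)
    then show ?thesis by (simp only: card_atLeastAtMost diff_Suc_1 coeff_root_poly_initial_combination)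
  qed
  show det: "itea_det ip q F x p k \<noteq> 0"
  proof (rule itea_det_nonzeroI)
    fix c assume c: "c k = 0" "\<And>i. i \<in> {1..k} \<Longrightarrow> (\<Sum>j\<le>k. itea_u ip q F x p i j * c j) = 0"
    have "(\<Sum>m\<in>{1..k}. cmod (poly (?Q c) (\<zeta> m))) \<le> 0" using bound[OF c(2)] c(1) by simp
    then have "(\<Sum>m\<in>{1..k}. cmod (poly (?Q c) (\<zeta> m))) = 0" by (intro antisym sum_nonneg) auto
    then have zero: "poly (?Q c) (\<zeta> m) = 0" if "m \<in> {1..k}" for m
      using that by (subst (asm) sum_nonneg_eq_0_iff) auto
    have "?Q c = smult (poly.coeff (?Q c) (card {1..k})) (root_poly \<zeta> {1..k})
           + (\<Sum>m\<in>{1..k}. smult (poly (?Q c) (\<zeta> m)) (lagrange_basis \<zeta> {1..k} m))"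
      by (rule lagrange_interpolation) (use sets degree_root_poly_initial_combination[of c x k] in simp_all)
    also have "(\<Sum>m\<in>{1..k}. smult (poly (?Q c) (\<zeta> m)) (lagrange_basis \<zeta> {1..k} m)) = 0"
      by (rule sum.neutral) (metis zero smult_0_left)
    also have "poly.coeff (?Q c) (card {1..k}) = 0"
      by (simp only: card_atLeastAtMost diff_Suc_1 coeff_root_poly_initial_combination c(1))
    finally show "?Q c = 0" by simp
  qed
  note sol = itea_coeffs_solution[OF det]
  show coeff: "poly.coeff P k = 1" unfolding P_def coeff_root_poly_initial_combination by (rule sol(1))
  show "degree P = k"
  proof (rule antisym)
    show "degree P \<le> k" unfolding P_def by (rule degree_root_poly_initial_combination)
    show "k \<le> degree P" by (rule le_degree) (simp add: coeff)
  qed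
  show "itea_denominator ip q F x p k = poly P" unfolding P_def by (rule itea_denominator_eq_poly)
  show "(\<Sum>m\<in>{1..k}. cmod (poly P (\<zeta> m))) \<le> 2 * M * M * \<eta>"
    using bound[OF sol(2)] unfolding sol(1) P_def by simp
  show "poly P (\<zeta> m) =
      - (\<Sum>s\<in>J. a s / a m * poly (lagrange_basis \<zeta> {1..k} m) (\<zeta> s) * (e m / e s) * poly P (\<zeta> s))"
    if "m \<in> {1..k}" for m
    unfolding P_def by (rule orthogonal_value_at_node[OF sets(1-4) orth[OF sol(2)]]) (use that nz e_nz in auto)
qed

section \<open>Limits of p-th roots\<close>

lemma root_cmod_divide: "root p (cmod (a / b)) = root p (cmod a) / root p (cmod b)"
  by (simp add: norm_divide real_root_divide)

text \<open>The p-th roots of the quotients tend to A / B < 1, so any \<theta> strictly between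
  gives a geometric majorant.\<close>

lemma ratio_tendsto_0_if_root_less:
  assumes a: "(\<lambda>p. root p (cmod (a p))) \<longlonglongrightarrow> A" and b: "(\<lambda>p. root p (cmod (b p))) \<longlonglongrightarrow> B"
    and AB: "A < B" "0 < B"
  shows "(\<lambda>p. a p / b p) \<longlonglongrightarrow> 0"
proof -
  have lim: "(\<lambda>p. root p (cmod (a p / b p))) \<longlonglongrightarrow> A / B"
    unfolding root_cmod_divide using AB by (intro tendsto_divide a b) auto
  have "A / B < 1" using AB by simp
  then obtain \<theta> where \<theta>: "A / B < \<theta>" "\<theta> < 1" using dense by blast
  have "A \<ge> 0"
    by (rule tendsto_lowerbound[OF a]) (auto intro: eventually_mono[OF eventually_gt_at_top[of 0]])
  then have "\<theta> > 0" using \<theta>(1) AB by (meson divide_nonneg_pos le_less_trans)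
  have "\<forall>\<^sub>F p in sequentially. norm (a p / b p) \<le> \<theta> ^ p"
    using order_tendstoD(2)[OF lim \<theta>(1)] eventually_gt_at_top[of 0]
  proof eventually_elim
    case (elim p)
    have "cmod (a p / b p) = root p (cmod (a p / b p)) ^ p" using elim by simp
    also have "\<dots> \<le> \<theta> ^ p" using elim by (intro power_mono) auto
    finally show ?case .
  qed
  moreover have "(\<lambda>p. \<theta> ^ p) \<longlonglongrightarrow> 0" using \<theta> \<open>\<theta> > 0\<close> by (intro LIMSEQ_realpow_zero) auto
  ultimately show ?thesis by (rule Lim_null_comparison)
qed

text \<open>The constant hidden in the O disappears because its p-th root tends to 1.\<close>

lemma limsup_root_le_if_bigo:
  fixes f :: "nat \<Rightarrow> complex"
  assumes f: "f \<in> O(\<lambda>p. a p / t p)"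
    and a: "(\<lambda>p. root p (cmod (a p))) \<longlonglongrightarrow> A" and t: "(\<lambda>p. root p (cmod (t p))) \<longlonglongrightarrow> B" "B \<noteq> 0"
  shows "limsup (\<lambda>p. ereal (root p (cmod (f p)))) \<le> ereal (A / B)"
proof -
  obtain C where C: "C > 0" "\<forall>\<^sub>F p in sequentially. norm (f p) \<le> C * norm (a p / t p)"
    using landau_o.bigE[OF f] by blast
  let ?g = "\<lambda>p. root p C * (root p (cmod (a p)) / root p (cmod (t p)))"
  have "?g \<longlonglongrightarrow> 1 * (A / B)"
    by (intro tendsto_mult tendsto_divide a t LIMSEQ_root_const C)
  then have "limsup (\<lambda>p. ereal (?g p)) = ereal (A / B)"
    by (intro lim_imp_Limsup) auto
  moreover have "limsup (\<lambda>p. ereal (root p (cmod (f p)))) \<le> limsup (\<lambda>p. ereal (?g p))"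
  proof (rule Limsup_mono)
    show "\<forall>\<^sub>F p in sequentially. ereal (root p (cmod (f p))) \<le> ereal (?g p)"
      using C(2) eventually_gt_at_top[of 0]
    proof eventually_elim
      case (elim p)
      then have "root p (cmod (f p)) \<le> root p (C * cmod (a p / t p))" by simp
      then show ?case by (simp add: real_root_mult root_cmod_divide)
    qed
  qed
  ultimately show ?thesis by simp
qed

text \<open>Factor V(z_m) over the labelled zeros: the factors other than the m-th have a nonzero
  limit and can be divided out. The error becomes an exact sum over the outer poles with convergent
  coefficients \<open>G\<close>, which yields both the O-bound and the refined asymptotics.\<close>

lemma labelled_zeros_error:
  assumes zp: "labelled_zeros V k \<zeta> zp" and m: "m \<in> {1..k}" and inj: "inj_on \<zeta> {1..k}"
    and V: "\<forall>\<^sub>F p in sequentially. V p (\<zeta> m) = - (\<Sum>s\<in>J. b s * d p s * V p (\<zeta> s))"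
  obtains G where "\<forall>\<^sub>F p in sequentially. zp p m - \<zeta> m = (\<Sum>s\<in>J. G p s * d p s)"
    and "\<And>s. (\<lambda>p. G p s) \<longlonglongrightarrow> b s * (\<Prod>i=1..k. \<zeta> s - \<zeta> i) / (\<Prod>i\<in>{1..k} - {m}. \<zeta> m - \<zeta> i)"
proof -
  let ?Q = "\<lambda>p. \<Prod>i\<in>{1..k} - {m}. \<zeta> m - zp p i" and ?W = "\<Prod>i\<in>{1..k} - {m}. \<zeta> m - \<zeta> i"
  have prod: "\<forall>\<^sub>F p in sequentially. \<forall>z. V p z = (\<Prod>i=1..k. z - zp p i)"
    and lim: "\<And>i. i \<in> {1..k} \<Longrightarrow> (\<lambda>p. zp p i) \<longlonglongrightarrow> \<zeta> i"
    using zp unfolding labelled_zeros_def by blast+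
  have Q: "?Q \<longlonglongrightarrow> ?W" by (intro tendsto_prod tendsto_diff tendsto_const lim) auto
  have "\<zeta> m \<noteq> \<zeta> i" if "i \<in> {1..k} - {m}" for i using inj m that by (auto dest: inj_onD)
  then have W: "?W \<noteq> 0" by (subst prod_zero_iff) auto
  let ?G = "\<lambda>p s. b s * V p (\<zeta> s) / ?Q p"
  show ?thesis
  proof (rule that[of ?G])
    show "\<forall>\<^sub>F p in sequentially. zp p m - \<zeta> m = (\<Sum>s\<in>J. ?G p s * d p s)"
      using V prod tendsto_imp_eventually_ne[OF Q W]
    proof eventually_elim
      case (elim p)
      have "V p (\<zeta> m) = (\<zeta> m - zp p m) * ?Q p"
        unfolding elim(2)[rule_format] by (rule prod.remove) (use m in auto)
      then have "zp p m - \<zeta> m = - V p (\<zeta> m) / ?Q p" using elim(3) by (simp add: field_simps)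
      also have "\<dots> = (\<Sum>s\<in>J. ?G p s * d p s)"
        unfolding elim(1) by (simp add: sum_divide_distrib mult_ac)
      finally show ?case .
    qed
    fix s
    have "(\<lambda>p. \<Prod>i=1..k. \<zeta> s - zp p i) \<longlonglongrightarrow> (\<Prod>i=1..k. \<zeta> s - \<zeta> i)"
      by (intro tendsto_prod tendsto_diff tendsto_const lim)
    then have "(\<lambda>p. V p (\<zeta> s)) \<longlonglongrightarrow> (\<Prod>i=1..k. \<zeta> s - \<zeta> i)"
      by (rule Lim_transform_eventually) (use prod in \<open>auto elim: eventually_mono\<close>)
    then show "(\<lambda>p. ?G p s) \<longlonglongrightarrow> b s * (\<Prod>i=1..k. \<zeta> s - \<zeta> i) / ?W"
      by (intro tendsto_divide tendsto_mult tendsto_const Q W)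
  qed
qed

text \<open>F is unconstrained at the poles themselves, so the argument uses limits: (z - z_s)
  F_i(z) would tend to 0 by continuity, but tends to the i-th component of v_s, chosen
  nonzero.\<close>

lemma pole_notin_analytic_set:
  fixes F :: "complex \<Rightarrow> complex ^ 'n"
  assumes F: "\<And>z. z \<notin> \<zeta> ` S \<Longrightarrow>
      F z = (\<Sum>s\<in>S. (1 / (z - \<zeta> s)) *s v s) + vec_lambda (\<lambda>i. poly (vec_nth U i) z)"
    and S: "finite S" "inj_on \<zeta> S" "s \<in> S" and v: "v s \<noteq> 0"
    and an: "\<And>i. (\<lambda>z. vec_nth (F z) i) analytic_on E"
  shows "\<zeta> s \<notin> E"
proof
  assume "\<zeta> s \<in> E"
  obtain i where i: "vec_nth (v s) i \<noteq> 0" using v by (auto simp: Finite_Cartesian_Product.vec_eq_iff)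
  let ?f = "\<lambda>z. vec_nth (F z) i"
  let ?r = "\<lambda>z. (\<Sum>t\<in>S - {s}. vec_nth (v t) i / (z - \<zeta> t)) + poly (vec_nth U i) z"
  have "?f analytic_on {\<zeta> s}" by (rule analytic_on_subset[OF an]) (use \<open>\<zeta> s \<in> E\<close> in auto)
  then have "isCont ?f (\<zeta> s)" by (rule analytic_at_imp_isCont)
  then have "((\<lambda>z. (z - \<zeta> s) * ?f z) \<longlongrightarrow> (\<zeta> s - \<zeta> s) * ?f (\<zeta> s)) (at (\<zeta> s))"
    unfolding isCont_def by (intro tendsto_mult tendsto_diff tendsto_ident_at tendsto_const)
  then have lim0: "((\<lambda>z. (z - \<zeta> s) * ?f z) \<longlongrightarrow> 0) (at (\<zeta> s))" by simp
  have ne: "\<zeta> s - \<zeta> t \<noteq> 0" if "t \<in> S - {s}" for t using S that by (auto dest: inj_onD)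
  have "((\<lambda>z. vec_nth (v s) i + (z - \<zeta> s) * ?r z) \<longlongrightarrow> vec_nth (v s) i + (\<zeta> s - \<zeta> s) * ?r (\<zeta> s)) (at (\<zeta> s))"
    by (intro tendsto_intros ne)
  moreover have "\<forall>\<^sub>F z in at (\<zeta> s). vec_nth (v s) i + (z - \<zeta> s) * ?r z = (z - \<zeta> s) * ?f z"
  proof -
    have "open (- (\<zeta> ` (S - {s})))" using S(1) by (intro open_Compl finite_imp_closed) auto
    moreover have "\<zeta> s \<in> - (\<zeta> ` (S - {s}))" using ne by force
    ultimately have "\<forall>\<^sub>F z in at (\<zeta> s). z \<in> - (\<zeta> ` (S - {s}))" by (rule eventually_at_in_open')
    moreover have "\<forall>\<^sub>F z in at (\<zeta> s). z \<noteq> \<zeta> s" by (rule eventually_neq_at_within)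
    ultimately show ?thesis
    proof eventually_elim
      case (elim z)
      then have "z \<notin> \<zeta> ` S" by auto
      then have "?f z = (\<Sum>t\<in>S. vec_nth (v t) i / (z - \<zeta> t)) + poly (vec_nth U i) z"
        by (simp add: F sum_component)
      also have "(\<Sum>t\<in>S. vec_nth (v t) i / (z - \<zeta> t)) = vec_nth (v s) i / (z - \<zeta> s)
          + (\<Sum>t\<in>S - {s}. vec_nth (v t) i / (z - \<zeta> t))"
        using S by (intro sum.remove) auto
      finally show ?case using elim(2) by (simp add: field_simps)
    qed
  qed
  ultimately have "((\<lambda>z. (z - \<zeta> s) * ?f z) \<longlongrightarrow> vec_nth (v s) i + (\<zeta> s - \<zeta> s) * ?r (\<zeta> s)) (at (\<zeta> s))"
    by (rule Lim_transform_eventually)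
  then have "0 = vec_nth (v s) i + (\<zeta> s - \<zeta> s) * ?r (\<zeta> s)"
    using lim0 by (intro tendsto_unique[OF trivial_limit_at])
  then show False using i by simp
qed

text \<open>Far away from the nodes all factors of \<open>\<Psi>\<^sub>p\<close> have modulus at least \<open>1\<close>; so the positivity
  of the capacity is forced by the asymptotic distribution of the nodes.\<close>

lemma node_limit_factor_pos:
  assumes "bounded E" and "\<And>z. Phi z > 0"
    and bdd: "bounded {\<xi> p i | p i. 1 \<le> p \<and> 1 \<le> i \<and> i \<le> p + k}"
    and lim: "\<And>z. z \<notin> E \<Longrightarrow> (\<lambda>p. root p (cmod (node_poly (\<xi> p) 1 (p + k) z))) \<longlonglongrightarrow> \<kappa> * Phi z"
  shows "\<kappa> > (0::real)"
proof -
  have "bounded (E \<union> {\<xi> p i | p i. 1 \<le> p \<and> 1 \<le> i \<and> i \<le> p + k})"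
    using assms by simp
  then obtain R where R: "R > 0" "\<And>z. z \<in> E \<union> {\<xi> p i | p i. 1 \<le> p \<and> 1 \<le> i \<and> i \<le> p + k} \<Longrightarrow> cmod z \<le> R"
    unfolding bounded_pos by blast
  define z where "z = complex_of_real (R + 1)"
  have z: "cmod z = R + 1" using R(1) unfolding z_def by simp
  then have "z \<notin> E" using R(2)[of z] by auto
  have "\<forall>\<^sub>F p in sequentially. 1 \<le> root p (cmod (node_poly (\<xi> p) 1 (p + k) z))"
    using eventually_ge_at_top[of 1]
  proof eventually_elim
    case (elim p)
    have "1 \<le> cmod (z - \<xi> p i)" if "i \<in> {1..p + k}" for i
    proof -
      have "cmod (\<xi> p i) \<le> R" by (rule R(2)) (use that elim in auto)
      then show ?thesis using norm_triangle_ineq2[of z "\<xi> p i"] z by simp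
    qed
    then have "1 \<le> cmod (node_poly (\<xi> p) 1 (p + k) z)"
      unfolding node_poly_def prod_norm[symmetric] by (intro prod_ge_1) auto
    then show ?case using elim by simp
  qed
  then have "1 \<le> \<kappa> * Phi z" by (intro tendsto_lowerbound[OF lim[OF \<open>z \<notin> E\<close>]]) auto
  then have "0 < \<kappa> * Phi z" by linarith
  then show ?thesis using assms(2)[of z] by (rule zero_less_mult_pos2)
qed

text \<open>The exchange identity turns the signed quotient of determinants into a ratio of weights
  times a Lagrange value. This identifies C_m with the limit coefficient at pole k + 1 in the error
  formula and shows that it depends on neither p nor the nodes.\<close>

lemma itea_C_eq:
  assumes m: "m \<in> {1..k}" and inj: "inj_on \<zeta> {1..k + 1}"
    and nz: "\<And>i. i \<in> {1..k} \<Longrightarrow> ip q (v i) \<noteq> 0"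
    and T: "itea_T ip q v \<zeta> x p k ([1..<m] @ [m + 1..<k + 2]) \<noteq> 0"
  shows "itea_C ip q v \<zeta> x p k m = ip q (v (k + 1)) / ip q (v m) * poly (lagrange_basis \<zeta> {1..k} m) (\<zeta> (k + 1))
      * (\<Prod>i=1..k. \<zeta> (k + 1) - \<zeta> i) / (\<Prod>i\<in>{1..k} - {m}. \<zeta> m - \<zeta> i)"
    and "itea_C ip q v \<zeta> x p k m \<noteq> 0"
proof -
  let ?T' = "itea_T ip q v \<zeta> x p k ([1..<m] @ [m + 1..<k + 2])" and ?T = "itea_T ip q v \<zeta> x p k [1..<k + 1]"
  let ?l = "poly (lagrange_basis \<zeta> {1..k} m) (\<zeta> (k + 1))"
  let ?r = "ip q (v (k + 1)) / ip q (v m) * ?l"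
  have "inj_on \<zeta> {1..k}" using inj by (rule inj_on_subset) auto
  then have ex: "(- 1) ^ (k - m) * ?T' = ?r * ?T" using m nz by (intro itea_T_exchange) auto
  \<comment> \<open>By the same identity, a nonzero numerator determinant forces the denominator
    determinant to be nonzero.\<close>
  then have "?r * ?T \<noteq> 0" using T by (metis mult_eq_0_iff power_not_zero neg_equal_0_iff_equal zero_neq_one)
  then have r: "?r \<noteq> 0" "?T \<noteq> 0" by auto
  then have sign: "(- 1) ^ (k - m) * (?T' / ?T) = ?r" using ex by (simp add: field_simps)
  have C: "itea_C ip q v \<zeta> x p k m = ?r * (\<zeta> (k + 1) - \<zeta> m) * ?l"
    unfolding itea_C_def sign poly_lagrange_basis ..
  have "(\<Prod>i=1..k. \<zeta> (k + 1) - \<zeta> i) = (\<zeta> (k + 1) - \<zeta> m) * (\<Prod>i\<in>{1..k} - {m}. \<zeta> (k + 1) - \<zeta> i)"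
    by (rule prod.remove) (use m in auto)
  then show "itea_C ip q v \<zeta> x p k m = ?r * (\<Prod>i=1..k. \<zeta> (k + 1) - \<zeta> i) / (\<Prod>i\<in>{1..k} - {m}. \<zeta> m - \<zeta> i)"
    unfolding C by (simp add: poly_lagrange_basis prod_dividef)
  have "\<zeta> (k + 1) \<noteq> \<zeta> m" using inj m by (auto dest: inj_onD)
  then show "itea_C ip q v \<zeta> x p k m \<noteq> 0" unfolding C using r by simp
qed

lemma tendsto_Min:
  fixes f :: "nat \<Rightarrow> 'b \<Rightarrow> real"
  assumes "finite A" "A \<noteq> {}" and lim: "\<And>j. j \<in> A \<Longrightarrow> (f j \<longlongrightarrow> L) F"
  shows "((\<lambda>p. Min ((\<lambda>j. f j p) ` A)) \<longlongrightarrow> L) F"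
proof (rule order_tendstoI)
  fix l assume "l < L"
  then have "\<forall>\<^sub>F p in F. \<forall>j\<in>A. l < f j p"
    using assms by (intro eventually_ball_finite ballI order_tendstoD(1)[OF lim])
  then show "\<forall>\<^sub>F p in F. l < Min ((\<lambda>j. f j p) ` A)" by eventually_elim (use assms in auto)
next
  fix u assume u: "L < u"
  obtain j where j: "j \<in> A" using assms(2) by auto
  have "\<forall>\<^sub>F p in F. f j p < u" by (rule order_tendstoD(2)[OF lim[OF j] u])
  then show "\<forall>\<^sub>F p in F. Min ((\<lambda>j. f j p) ` A) < u"
    by eventually_elim (use assms(1) j in \<open>auto intro: le_less_trans[OF Min_le]\<close>)
qed

theorem theorem5p3:
  fixes E :: "complex set"
    and g Phi :: "complex \<Rightarrow> real"
    and \<kappa> :: real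
    and \<xi> :: "nat \<Rightarrow> nat \<Rightarrow> complex"
    and ip :: "complex ^ 'n \<Rightarrow> complex ^ 'n \<Rightarrow> complex"
    and q :: "complex ^ 'n"
    and F :: "complex \<Rightarrow> complex ^ 'n"
    and v :: "nat \<Rightarrow> complex ^ 'n"
    and \<zeta> :: "nat \<Rightarrow> complex"
    and U :: "complex poly ^ 'n"
    and \<mu> k r :: nat
    and Psi :: "nat \<Rightarrow> complex \<Rightarrow> complex"
    and Psit :: "nat \<Rightarrow> complex"
    and V :: "nat \<Rightarrow> complex \<Rightarrow> complex"
  assumes E: "closed E" "bounded E"
    and green: "classical_green_function E g"
    and Phi: "\<And>z. Phi z = exp (g z)"
    and kappa: "\<kappa> = logarithmic_capacity E"
    and consecutive: "\<And>p i j l. \<lbrakk>1 \<le> p; 1 \<le> i; i \<le> j; j \<le> l; l \<le> p + k; \<xi> p i = \<xi> p l\<rbrakk>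
                        \<Longrightarrow> \<xi> p j = \<xi> p i"
    and no_limit_points: "\<And>w. w \<in> - E \<Longrightarrow> \<not> w islimpt {\<xi> p i | p i. 1 \<le> p \<and> 1 \<le> i \<and> i \<le> p + k}"
    and no_limit_point_at_infinity: "bounded {\<xi> p i | p i. 1 \<le> p \<and> 1 \<le> i \<and> i \<le> p + k}"
    and Psi: "\<And>p z. Psi p z = node_poly (\<xi> p) 1 (p + k) z"
    and nodes: "\<And>S. \<lbrakk>compact S; S \<subseteq> - E\<rbrakk> \<Longrightarrow>
                  uniform_limit S (\<lambda>p z. root p (cmod (Psi p z))) (\<lambda>z. \<kappa> * Phi z) sequentially"
    and ip: "inner_product_on_Cn ip"
    and q: "q \<noteq> 0"
    and F: "\<And>z. z \<notin> \<zeta> ` {1..\<mu>} \<Longrightarrow>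
              F z = (\<Sum>s=1..\<mu>. (1 / (z - \<zeta> s)) *s v s) + vec_lambda (\<lambda>i. poly (vec_nth U i) z)"
    and distinct_poles: "inj_on \<zeta> {1..\<mu>}"
    and v: "\<And>s. s \<in> {1..\<mu>} \<Longrightarrow> v s \<noteq> 0"
    and F_analytic: "\<And>i. (\<lambda>z. vec_nth (F z) i) analytic_on E"
    and ordered: "\<And>s t. \<lbrakk>1 \<le> s; s \<le> t; t \<le> \<mu>\<rbrakk> \<Longrightarrow> Phi (\<zeta> s) \<le> Phi (\<zeta> t)"
    and k: "1 \<le> k" "k < \<mu>"
    and r: "1 \<le> r" "k + r \<le> \<mu>"
    and gap_below: "Phi (\<zeta> k) < Phi (\<zeta> (k + 1))"
    and level: "\<And>j. j \<in> {1..r} \<Longrightarrow> Phi (\<zeta> (k + j)) = Phi (\<zeta> (k + 1))"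
    and gap_above: "k + r < \<mu> \<Longrightarrow> Phi (\<zeta> (k + r)) < Phi (\<zeta> (k + r + 1))"
    and qv: "(\<Prod>i=1..k. ip q (v i)) \<noteq> 0"
    and Psit: "\<And>p. cmod (Psit p) = Min ((\<lambda>j. cmod (Psi p (\<zeta> (k + j)))) ` {1..r})"
    and V: "\<And>p. V p = itea_denominator ip q F (\<xi> p) p k"
  shows "(\<forall>\<^sub>F p in sequentially. itea_det ip q F (\<xi> p) p k \<noteq> 0) \<and>
    (\<exists>zp. labelled_zeros V k \<zeta> zp) \<and>
    (\<forall>zp. labelled_zeros V k \<zeta> zp \<longrightarrow>
      (\<forall>m\<in>{1..k}.
        (\<lambda>p. zp p m - \<zeta> m) \<in> O(\<lambda>p. Psi p (\<zeta> m) / Psit p) \<and>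
        limsup (\<lambda>p. ereal (root p (cmod (zp p m - \<zeta> m)))) \<le> ereal (Phi (\<zeta> m) / Phi (\<zeta> (k + 1))) \<and>
        (r = 1 \<longrightarrow>
          (\<forall>p\<^sub>0\<ge>1. itea_T ip q v \<zeta> (\<xi> p\<^sub>0) p\<^sub>0 k ([1..<m] @ [m + 1..<k + 2]) \<noteq> 0 \<longrightarrow>
            (\<lambda>p. zp p m - \<zeta> m) \<sim>[sequentially]
              (\<lambda>p. itea_C ip q v \<zeta> (\<xi> p\<^sub>0) p\<^sub>0 k m * (Psi p (\<zeta> m) / Psi p (\<zeta> (k + 1))))))))"
proof -
  define I where "I = {1..k}"
  define J where "J = {k + 1..\<mu>}"
  define e where "e p s = Psi p (\<zeta> s)" for p s
  define a where "a s = ip q (v s)" for s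
  define l where "l m s = poly (lagrange_basis \<zeta> {1..k} m) (\<zeta> s)" for m s
  define P where "P p = (\<Sum>j\<le>k. smult (itea_coeffs ip q F (\<xi> p) p k j) (root_poly (\<xi> p) {1..j}))" for p
  have e_node: "e p s = node_poly (\<xi> p) 1 (p + k) (\<zeta> s)" for p s unfolding e_def Psi ..
  have finite_IJ: "finite I" "finite J" unfolding I_def J_def by auto
  have mem: "s \<in> {1..\<mu>}" if "s \<in> I \<or> s \<in> J" for s using that k unfolding I_def J_def by auto
  have inj_I: "inj_on \<zeta> {1..k}" "inj_on \<zeta> {1..k + 1}"
    using distinct_poles k by (auto intro: inj_on_subset)
  have a_nz: "a m \<noteq> 0" if "m \<in> {1..k}" for m using qv that unfolding a_def by (auto simp: prod_zero_iff)
  have Phi_pos: "Phi z > 0" for z by (simp add: Phi)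
  have lim: "(\<lambda>p. root p (cmod (Psi p z))) \<longlonglongrightarrow> \<kappa> * Phi z" if "z \<notin> E" for z
    by (rule tendsto_uniform_limitI[OF nodes[of "{z}"]]) (use that in auto)
  have \<kappa>: "\<kappa> > 0"
    by (rule node_limit_factor_pos[where Phi = Phi, OF E(2) Phi_pos no_limit_point_at_infinity]) (use lim in \<open>simp add: Psi\<close>)
  have root_lim: "(\<lambda>p. root p (cmod (e p s))) \<longlonglongrightarrow> \<kappa> * Phi (\<zeta> s)" if "s \<in> {1..\<mu>}" for s
    unfolding e_def
  proof (rule lim)
    show "\<zeta> s \<notin> E"
      by (rule pole_notin_analytic_set[where v = v and S = "{1..\<mu>}"],
          rule F, assumption, simp, rule distinct_poles, rule that, rule v, rule that, rule F_analytic)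
  qed
  have e_nz: "\<forall>\<^sub>F p in sequentially. \<forall>s\<in>{1..\<mu>}. e p s \<noteq> 0"
  proof (intro eventually_ball_finite ballI)
    fix s assume "s \<in> {1..\<mu>}"
    from tendsto_imp_eventually_ne[OF root_lim[OF this], of 0] have "\<forall>\<^sub>F p in sequentially. root p (cmod (e p s)) \<noteq> 0"
      using \<kappa> Phi_pos[of "\<zeta> s"] by simp
    then show "\<forall>\<^sub>F p in sequentially. e p s \<noteq> 0" by eventually_elim auto
  qed simp
  have ratio: "(\<lambda>p. e p s / e p t) \<longlonglongrightarrow> 0"
    if "s \<in> {1..\<mu>}" "t \<in> {1..\<mu>}" "Phi (\<zeta> s) < Phi (\<zeta> t)" for s t
    by (rule ratio_tendsto_0_if_root_less[OF root_lim root_lim]) (use that \<kappa> Phi_pos[of "\<zeta> t"] in auto)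
  have Phi_IJ: "Phi (\<zeta> m) < Phi (\<zeta> s)" if "m \<in> I" "s \<in> J" for m s
  proof -
    have "Phi (\<zeta> m) \<le> Phi (\<zeta> k)" "Phi (\<zeta> (k + 1)) \<le> Phi (\<zeta> s)"
      using that k unfolding I_def J_def by (auto intro: ordered)
    then show ?thesis using gap_below by linarith
  qed

  define \<eta> where "\<eta> p = (\<Sum>m\<in>{1..k}. \<Sum>s\<in>J. cmod (e p m / e p s))" for p
  have "(\<lambda>p. \<Sum>m\<in>{1..k}. \<Sum>s\<in>J. cmod (e p m / e p s)) \<longlonglongrightarrow> (\<Sum>m\<in>{1..k}. \<Sum>s\<in>J. 0)"
    by (intro tendsto_sum tendsto_norm_zero ratio) (use mem Phi_IJ in \<open>auto simp: I_def\<close>)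
  then have \<eta>: "\<eta> \<longlonglongrightarrow> 0" unfolding \<eta>_def by simp
  obtain M where M: "M \<ge> 0" "\<And>m s. m \<in> {1..k} \<Longrightarrow> s \<in> J \<Longrightarrow> cmod (a s / a m * l m s) \<le> M"
    "\<And>m s. m \<in> {1..k} \<Longrightarrow> s \<in> J \<Longrightarrow> cmod (l m s) \<le> M"
    "\<And>s. s \<in> J \<Longrightarrow> cmod (poly (root_poly \<zeta> {1..k}) (\<zeta> s)) \<le> M"
  proof -
    \<comment> \<open>Finitely many quantities independent of p; the inserted 0 ensures
      \<open>M \<ge> 0\<close>.\<close>
    define X where "X = insert 0 ((\<Union>m\<in>{1..k}. \<Union>s\<in>J. {cmod (a s / a m * l m s), cmod (l m s)})
      \<union> (\<Union>s\<in>J. {cmod (poly (root_poly \<zeta> {1..k}) (\<zeta> s))}))"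
    have "finite X" unfolding X_def using finite_IJ by simp
    then show ?thesis
      by (intro that[of "Max X"]; intro Max_ge, assumption; unfold X_def, blast)
  qed
  have "(\<lambda>p. M * M * \<eta> p) \<longlonglongrightarrow> M * M * 0" by (intro tendsto_intros \<eta>)
  then have small: "\<forall>\<^sub>F p in sequentially. M * M * \<eta> p < 1 / 2" by (rule order_tendstoD(2)) simp
  \<comment> \<open>There are finitely many components, so one threshold beats all degrees of the
    polynomial part.\<close>
  have large: "\<forall>\<^sub>F p in sequentially. \<forall>i\<in>UNIV. degree (vec_nth U i) + k < p"
    by (intro eventually_ball_finite ballI eventually_gt_at_top) auto
  have core: "\<forall>\<^sub>F p in sequentially. itea_det ip q F (\<xi> p) p k \<noteq> 0
      \<and> (degree (P p) = k \<and> poly.coeff (P p) k = 1 \<and> V p = poly (P p))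
      \<and> (\<Sum>m\<in>{1..k}. cmod (poly (P p) (\<zeta> m))) \<le> 2 * M * M * \<eta> p
      \<and> (\<forall>m\<in>{1..k}. V p (\<zeta> m) = - (\<Sum>s\<in>J. a s / a m * l m s * (e p m / e p s) * V p (\<zeta> s)))"
    using e_nz small large eventually_ge_at_top[of 1]
  proof eventually_elim
    case (elim p)
    have adj: "equal_points_adjacent (\<xi> p) 1 (p + k)"
      unfolding equal_points_adjacent_def by (intro allI impI) (rule consecutive[of p], use elim(4) in auto)
    note est = itea_estimates[of ip \<zeta> \<mu> F v U "\<xi> p" p k q M "\<eta> p", OF ip F adj, folded e_node a_def J_def l_def, folded P_def]
    have "degree (vec_nth U i) + k < p" for i using elim(3) by simp
    note est = est[OF _ elim(1)[rule_format] this k(2) distinct_poles a_nz M(2,3,4,1) \<eta>_def less_imp_le[OF elim(2)]]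
    show ?case using est by (simp add: V)
  qed
  have det: "\<forall>\<^sub>F p in sequentially. itea_det ip q F (\<xi> p) p k \<noteq> 0"
    and mon: "\<forall>\<^sub>F p in sequentially. degree (P p) = k \<and> poly.coeff (P p) k = 1 \<and> V p = poly (P p)"
    and bound: "\<forall>\<^sub>F p in sequentially. (\<Sum>m\<in>{1..k}. cmod (poly (P p) (\<zeta> m))) \<le> 2 * M * M * \<eta> p"
    and node_value: "\<And>m. m \<in> {1..k} \<Longrightarrow> \<forall>\<^sub>F p in sequentially.
      V p (\<zeta> m) = - (\<Sum>s\<in>J. a s / a m * l m s * (e p m / e p s) * V p (\<zeta> s))"
    using core by (auto elim: eventually_mono)
  have zeros: "\<exists>zp. labelled_zeros V k \<zeta> zp"
  proof (rule labelled_zeros_exist[OF inj_I(1) k(1) mon])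
    fix m assume m: "m \<in> {1..k}"
    have "(\<lambda>p. 2 * M * M * \<eta> p) \<longlonglongrightarrow> 2 * M * M * 0" by (intro tendsto_intros \<eta>)
    then have "(\<lambda>p. 2 * M * M * \<eta> p) \<longlonglongrightarrow> 0" by simp
    moreover have "\<forall>\<^sub>F p in sequentially. norm (poly (P p) (\<zeta> m)) \<le> 2 * M * M * \<eta> p"
      using bound
    proof eventually_elim
      case (elim p)
      have "cmod (poly (P p) (\<zeta> m)) \<le> (\<Sum>m\<in>{1..k}. cmod (poly (P p) (\<zeta> m)))"
        using m by (intro member_le_sum) auto
      then show ?case using elim by linarith
    qed
    ultimately show "(\<lambda>p. poly (P p) (\<zeta> m)) \<longlonglongrightarrow> 0" by (rule Lim_null_comparison[rotated])
  qed

  have level_mem: "k + j \<in> {1..\<mu>}" if "j \<in> {1..r}" for j using that r by auto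
  have Psit_e: "cmod (Psit p) = Min ((\<lambda>j. cmod (e p (k + j))) ` {1..r})" for p
    unfolding e_def by (rule Psit)
  \<comment> \<open>\<open>root p\<close> is monotone and commutes with the minimum; the r terms
    share one limit since their poles lie on a common level curve of Phi.\<close>
  have "root p (cmod (Psit p)) = Min ((\<lambda>j. root p (cmod (e p (k + j)))) ` {1..r})" if "p > 0" for p
  proof -
    have "mono (root p)" using that by (intro monoI) simp
    then have "root p (Min ((\<lambda>j. cmod (e p (k + j))) ` {1..r})) = Min (root p ` (\<lambda>j. cmod (e p (k + j))) ` {1..r})"
      by (rule mono_Min_commute) (use r in auto)
    then show ?thesis unfolding Psit_e by (simp add: image_image)
  qed
  then have "\<forall>\<^sub>F p in sequentially. Min ((\<lambda>j. root p (cmod (e p (k + j)))) ` {1..r}) = root p (cmod (Psit p))"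
    by (auto intro: eventually_mono[OF eventually_gt_at_top[of 0]])
  moreover have "(\<lambda>p. Min ((\<lambda>j. root p (cmod (e p (k + j)))) ` {1..r})) \<longlonglongrightarrow> \<kappa> * Phi (\<zeta> (k + 1))"
  proof (rule tendsto_Min)
    fix j assume j: "j \<in> {1..r}"
    show "(\<lambda>p. root p (cmod (e p (k + j)))) \<longlonglongrightarrow> \<kappa> * Phi (\<zeta> (k + 1))"
      using root_lim[OF level_mem[OF j]] level[OF j] by simp
  qed (use r in auto)
  ultimately have root_Psit: "(\<lambda>p. root p (cmod (Psit p))) \<longlonglongrightarrow> \<kappa> * Phi (\<zeta> (k + 1))"
    by (rule Lim_transform_eventually[rotated])
  have Psit_nz: "\<forall>\<^sub>F p in sequentially. Psit p \<noteq> 0"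
  proof -
    have "\<forall>\<^sub>F p in sequentially. root p (cmod (Psit p)) \<noteq> 0"
      using tendsto_imp_eventually_ne[OF root_Psit, of 0] \<kappa> Phi_pos[of "\<zeta> (k + 1)"] by simp
    then show ?thesis by eventually_elim auto
  qed
  have Phi_above: "Phi (\<zeta> (k + 1)) < Phi (\<zeta> s)" if "s \<in> J" "s > k + r" for s
  proof -
    have "Phi (\<zeta> (k + r)) = Phi (\<zeta> (k + 1))" using level[of r] r by simp
    moreover have "Phi (\<zeta> (k + r)) < Phi (\<zeta> (k + r + 1))" using gap_above that unfolding J_def by simp
    moreover have "Phi (\<zeta> (k + r + 1)) \<le> Phi (\<zeta> s)" using that unfolding J_def by (intro ordered) auto
    ultimately show ?thesis by linarith
  qed
  \<comment> \<open>On the critical level this is the definition of the minimum. Beyond it,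
    Psi_p(z_{k+1}) is eventually dominated by Psi_p(z_s).\<close>
  have Psit_le: "\<forall>\<^sub>F p in sequentially. cmod (Psit p) \<le> cmod (e p s)" if s: "s \<in> J" for s
  proof (cases "s \<le> k + r")
    case True
    then have "s - k \<in> {1..r}" "k + (s - k) = s" using s unfolding J_def by auto
    then have "cmod (Psit p) \<le> cmod (e p s)" for p
      unfolding Psit_e by (intro Min_le) (auto intro!: image_eqI[of _ _ "s - k"])
    then show ?thesis by simp
  next
    case False
    have k1: "k + 1 \<in> {1..\<mu>}" using k by auto
    have "(\<lambda>p. e p (k + 1) / e p s) \<longlonglongrightarrow> 0"
      by (rule ratio[OF k1 mem]) (use False s Phi_above in auto)
    then have "\<forall>\<^sub>F p in sequentially. cmod (e p (k + 1) / e p s) < 1"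
      by (intro order_tendstoD(2)[OF tendsto_norm_zero]) auto
    then show ?thesis
      using e_nz
    proof eventually_elim
      case (elim p)
      have "e p s \<noteq> 0" using elim(2) mem s by blast
      then have "cmod (e p (k + 1)) \<le> cmod (e p s)" using elim(1) by (simp add: norm_divide divide_simps)
      moreover have "cmod (Psit p) \<le> cmod (e p (k + 1))"
        unfolding Psit_e using r by (intro Min_le) (auto intro!: image_eqI[of _ _ 1])
      ultimately show ?case by linarith
    qed
  qed

  have claims: "(\<lambda>p. zp p m - \<zeta> m) \<in> O(\<lambda>p. Psi p (\<zeta> m) / Psit p) \<and>
        limsup (\<lambda>p. ereal (root p (cmod (zp p m - \<zeta> m)))) \<le> ereal (Phi (\<zeta> m) / Phi (\<zeta> (k + 1))) \<and>
        (r = 1 \<longrightarrow>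
          (\<forall>p\<^sub>0\<ge>1. itea_T ip q v \<zeta> (\<xi> p\<^sub>0) p\<^sub>0 k ([1..<m] @ [m + 1..<k + 2]) \<noteq> 0 \<longrightarrow>
            (\<lambda>p. zp p m - \<zeta> m) \<sim>[sequentially]
              (\<lambda>p. itea_C ip q v \<zeta> (\<xi> p\<^sub>0) p\<^sub>0 k m * (Psi p (\<zeta> m) / Psi p (\<zeta> (k + 1))))))"
    if zp: "labelled_zeros V k \<zeta> zp" and m: "m \<in> {1..k}" for zp m
  proof -
    let ?g = "\<lambda>s. a s / a m * l m s * (\<Prod>i=1..k. \<zeta> s - \<zeta> i) / (\<Prod>i\<in>{1..k} - {m}. \<zeta> m - \<zeta> i)"
    obtain G where G: "\<forall>\<^sub>F p in sequentially. zp p m - \<zeta> m = (\<Sum>s\<in>J. G p s * (e p m / e p s))"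
      and G_lim: "\<And>s. (\<lambda>p. G p s) \<longlonglongrightarrow> ?g s"
      using labelled_zeros_error[OF zp m inj_I(1) node_value[OF m]] by blast
    have bigo: "(\<lambda>p. zp p m - \<zeta> m) \<in> O(\<lambda>p. e p m / Psit p)"
    proof -
      have "(\<lambda>p. G p s * (e p m / e p s)) \<in> O(\<lambda>p. 1 * (e p m / Psit p))" if s: "s \<in> J" for s
      proof (rule landau_o.big.mult)
        show "(\<lambda>p. G p s) \<in> O(\<lambda>p. 1)" by (rule bigoI_tendsto[of _ _ "?g s"]) (use G_lim[of s] in auto)
        show "(\<lambda>p. e p m / e p s) \<in> O(\<lambda>p. e p m / Psit p)"
        proof (rule landau_o.bigI[of 1])
          show "\<forall>\<^sub>F p in sequentially. norm (e p m / e p s) \<le> 1 * norm (e p m / Psit p)"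
            using Psit_le[OF s] Psit_nz
          proof eventually_elim
            case (elim p)
            then show ?case by (auto simp: norm_divide intro!: divide_left_mono mult_pos_pos)
          qed
        qed simp
      qed
      then have "(\<lambda>p. \<Sum>s\<in>J. G p s * (e p m / e p s)) \<in> O(\<lambda>p. e p m / Psit p)"
        by (intro big_sum_in_bigo) simp
      then show ?thesis using landau_o.big.in_cong[OF G] by simp
    qed
    moreover have "limsup (\<lambda>p. ereal (root p (cmod (zp p m - \<zeta> m)))) \<le> ereal (\<kappa> * Phi (\<zeta> m) / (\<kappa> * Phi (\<zeta> (k + 1))))"
      by (rule limsup_root_le_if_bigo[OF bigo root_lim root_Psit])
         (use m k \<kappa> Phi_pos[of "\<zeta> (k + 1)"] in auto)
    moreover have "(\<lambda>p. zp p m - \<zeta> m) \<sim>[sequentially]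
        (\<lambda>p. itea_C ip q v \<zeta> (\<xi> p\<^sub>0) p\<^sub>0 k m * (e p m / e p (k + 1)))"
      if r1: "r = 1" and T: "itea_T ip q v \<zeta> (\<xi> p\<^sub>0) p\<^sub>0 k ([1..<m] @ [m + 1..<k + 2]) \<noteq> 0" for p\<^sub>0
    proof -
      let ?C = "itea_C ip q v \<zeta> (\<xi> p\<^sub>0) p\<^sub>0 k m"
      have C: "?C = ?g (k + 1)" "?C \<noteq> 0"
        unfolding a_def l_def by (rule itea_C_eq[OF m inj_I(2) a_nz[unfolded a_def] T], assumption)+
      have k1: "k + 1 \<in> J" using k unfolding J_def by simp
      \<comment> \<open>The error formula is rescaled by Psi_p(z_{k+1}) / Psi_p(z_m). Since r = 1,
        all outer poles other than k + 1 lie on strictly higher levels, and their terms vanish in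
        the limit.\<close>
      have "(\<lambda>p. G p s * (e p (k + 1) / e p s)) \<longlonglongrightarrow> (if s = k + 1 then ?C else 0)" if s: "s \<in> J" for s
      proof (cases "s = k + 1")
        case True
        have "\<forall>\<^sub>F p in sequentially. G p (k + 1) = G p (k + 1) * (e p (k + 1) / e p (k + 1))"
          using e_nz by eventually_elim (use mem k1 in auto)
        from Lim_transform_eventually[OF G_lim this]
        have "(\<lambda>p. G p (k + 1) * (e p (k + 1) / e p (k + 1))) \<longlonglongrightarrow> ?C"
          unfolding C(1) .
        then show ?thesis by (subst if_P[OF True]) (simp only: True)
      next
        case False
        then have "(\<lambda>p. e p (k + 1) / e p s) \<longlonglongrightarrow> 0"
          by (intro ratio mem) (use k1 s r1 False Phi_above[of s] in \<open>auto simp: J_def\<close>)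
        from tendsto_mult[OF G_lim this] show ?thesis using False by simp
      qed
      then have "(\<lambda>p. \<Sum>s\<in>J. G p s * (e p (k + 1) / e p s)) \<longlonglongrightarrow> (\<Sum>s\<in>J. if s = k + 1 then ?C else 0)"
        by (rule tendsto_sum)
      also have "(\<Sum>s\<in>J. if s = k + 1 then ?C else 0) = ?C" using k1 finite_IJ by simp
      finally have "(\<lambda>p. (\<Sum>s\<in>J. G p s * (e p (k + 1) / e p s)) / ?C) \<longlonglongrightarrow> ?C / ?C"
        by (rule tendsto_divide[OF _ tendsto_const C(2)])
      then have lim1: "(\<lambda>p. (\<Sum>s\<in>J. G p s * (e p (k + 1) / e p s)) / ?C) \<longlonglongrightarrow> 1" using C(2) by simp
      have "\<forall>\<^sub>F p in sequentially. (\<Sum>s\<in>J. G p s * (e p (k + 1) / e p s)) / ?C =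
          (zp p m - \<zeta> m) / (?C * (e p m / e p (k + 1)))"
        using G e_nz
      proof eventually_elim
        case (elim p)
        have nz: "e p (k + 1) \<noteq> 0" "e p m \<noteq> 0" using elim(2) mem k1 m by (auto simp: I_def)
        have "(zp p m - \<zeta> m) / (?C * (e p m / e p (k + 1))) = (\<Sum>s\<in>J. G p s * (e p m / e p s)) * (e p (k + 1) / e p m) / ?C"
          unfolding elim(1) by simp
        also have "(\<Sum>s\<in>J. G p s * (e p m / e p s)) * (e p (k + 1) / e p m) = (\<Sum>s\<in>J. G p s * (e p (k + 1) / e p s))"
          unfolding sum_distrib_right by (intro sum.cong refl) (use nz in simp)
        finally show ?case ..
      qed
      from Lim_transform_eventually[OF lim1 this] show ?thesis by (rule asymp_equivI')
    qed
    ultimately show ?thesis unfolding e_def using \<kappa> by simp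
  qed
  show ?thesis using det zeros claims by blast
qed

end
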